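(* Let $f$ be a transcendental entire function. Then the set of all $z\in\mathbb{C}$ such that $\chi(f,z)=\infty$ is dense in the Julia set $J(f)$.
   Context: $f^n$ denotes the $n$-th iterate of $f$. The Julia set $J(f)$ is the set of all points of $\mathbb{C}$ having no neighborhood in which the iterates $(f^n)_{n\in\mathbb{N}}$ form a normal family. For an entire function $g$, the spherical derivative is $g^\#(z)=\frac{|g'(z)|}{1+|g(z)|^2}$. The Lyapunov exponent of $f$ at $z$ is $\chi(f,z)=\lim_{n\to\infty}\frac1n\log (f^n)^\#(z)$ when this limit exists in $[-\infty,\infty]$; thus $\chi(f,z)=\infty$ means that $\frac1n\log (f^n)^\#(z)\to\infty$ as $n\to\infty$. *)

theory Defs
  imports
    "HOL-Complex_Analysis.Complex_Analysis"
    "HOL-Computational_Algebra.Polynomial"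
    "HOL-Library.Extended_Real"
begin

definition transcendental_entire :: "(complex \<Rightarrow> complex) \<Rightarrow> bool" where
  "transcendental_entire f \<longleftrightarrow>
     f holomorphic_on UNIV \<and> \<not> (\<exists>p. \<forall>z. f z = poly p z)"

definition locally_uniform_limit ::
    "complex set \<Rightarrow> (nat \<Rightarrow> complex \<Rightarrow> complex) \<Rightarrow> (complex \<Rightarrow> complex) \<Rightarrow> bool" where
  "locally_uniform_limit U F g \<longleftrightarrow>
     (\<forall>K. compact K \<and> K \<subseteq> U \<longrightarrow> uniform_limit K F g sequentially)"

definition locally_uniform_limit_infinity ::
    "complex set \<Rightarrow> (nat \<Rightarrow> complex \<Rightarrow> complex) \<Rightarrow> bool" where
  "locally_uniform_limit_infinity U F \<longleftrightarrow>
     (\<forall>K. compact K \<and> K \<subseteq> U \<longrightarrow> (\<forall>B. \<forall>\<^sub>F n in sequentially. \<forall>z\<in>K. B < cmod (F n z)))"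

text \<open>
  Normality in the sense of Montel for a family of holomorphic functions, with the
  constant limit \<open>\<infinity>\<close> allowed.  It is meant for a domain (open connected set) \<open>U\<close>: on a
  disconnected open set, a limit in the spherical metric could be finite on one component
  and \<open>\<infinity>\<close> on another.
\<close>

definition normal_family_on ::
    "complex set \<Rightarrow> (complex \<Rightarrow> complex) set \<Rightarrow> bool" where
  "normal_family_on U \<F> \<longleftrightarrow>
     (\<forall>F :: nat \<Rightarrow> complex \<Rightarrow> complex. range F \<subseteq> \<F> \<longrightarrow>
        (\<exists>r :: nat \<Rightarrow> nat. strict_mono r \<and>
           ((\<exists>g. g holomorphic_on U \<and> locally_uniform_limit U (F \<circ> r) g) \<or>
            locally_uniform_limit_infinity U (F \<circ> r))))"

definition Julia_set :: "(complex \<Rightarrow> complex) \<Rightarrow> complex set" where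
  "Julia_set f =
     {z. \<not> (\<exists>U. open U \<and> connected U \<and> z \<in> U \<and> normal_family_on U (range (\<lambda>n. f ^^ n)))}"

definition spherical_deriv :: "(complex \<Rightarrow> complex) \<Rightarrow> complex \<Rightarrow> real" where
  "spherical_deriv g z = cmod (deriv g z) / (1 + (cmod (g z))\<^sup>2)"

text \<open>Logarithm of a nonnegative real with \<open>log 0 = -\<infinity>\<close>; the library has \<open>ln 0 = 0\<close>.\<close>

definition log_ereal :: "real \<Rightarrow> ereal" where
  "log_ereal x = (if x = 0 then -\<infinity> else ereal (ln x))"

definition has_Lyapunov_exponent ::
    "(complex \<Rightarrow> complex) \<Rightarrow> complex \<Rightarrow> ereal \<Rightarrow> bool" where
  "has_Lyapunov_exponent f z L \<longleftrightarrow>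
     (\<lambda>n. ereal (1 / real n) * log_ereal (spherical_deriv (f ^^ n) z)) \<longlonglongrightarrow> L"

end

theory Submission
  imports Defs
begin

text \<open>
  Why the theorem holds.  If $f^N(x) = x$ and $|(f^N)'(x)| > A^N$, the spherical derivatives
  of the iterates at $x$ grow at least like $A^n$.  So periodic points alone give large but finite
  exponents, and the exponent $\infty$ is obtained in a limit: near a repelling periodic point
  $x$ one finds a periodic point $y$ that is more repelling, and an orbit that follows the cycle
  of $x$ for a long time before it settles in the cycle of $y$.  The long stay makes the derivative so
  large that the way from one cycle to the other costs nothing
  (\<open>perturb_to_larger_exponent\<close>).  Repeating this with ever larger exponents, and with
  perturbations that are small enough to keep the estimates obtained so far, yields a point whose exponent is
  infinite.  Growth of the spherical derivatives also puts that point into the Julia set.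

  What has to be shown is that periodic points with $|(f^N)'(x)| > M^N$ are dense in the Julia set for
  every $M$ (\<open>periodic_points_of_large_multiplier_dense\<close>).  This is where transcendence
  enters.  A transcendental entire function maps large discs over much larger circles, so that
  $\log|f^n|$ grows faster than any exponential on circles
  (\<open>iterates_superexponential_on_circles\<close>).  By Montel's theorem, every neighbourhood of a point
  of the Julia set is mapped over such a circle, and at infinitely many times $n$ it contains both
  points with $|f^n| \le 1$ and points with $\log|f^n| \ge A^n$ (\<open>Julia_explosion\<close>).

  Applied to the nearest point of $\{|F| \le 1\}$, Harnack's inequality for $\log|F|$ shows that such a
  contrast forces the derivative to be at least of the order $A^n$ at a point where $|f^n| \le 1$
  (\<open>large_derivative_where_bounded_by_one\<close>).  The same inequality makes suitable rescalings
  locally bounded (\<open>rescaling_point\<close>), so rescaled iterates $f^{n_k}(q_k + \rho_k\zeta)$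
  converge to a nonconstant entire function $G$ while $\rho_k$ is superexponentially small in $n_k$.
  If the point $p$ to which the $q_k$ converge is generic, some $f^T \circ G$ takes the value $p$ at
  a noncritical point, and Hurwitz's theorem gives points near $p$ of period $T + n_k$ and
  multiplier comparable to $1/\rho_k$.

  A point of the Julia set is generic if it lies outside a certain countable set.  That there
  are such points everywhere in the Julia set follows from its being perfect
  (\<open>Julia_set_no_isolated_points\<close>, \<open>uncountable_Julia_set_ball\<close>).
\<close>



section \<open>Normality of the iterates\<close>

lemma holomorphic_on_compow:
  fixes f :: "complex \<Rightarrow> complex"
  assumes "f holomorphic_on UNIV"
  shows "f ^^ n holomorphic_on A"
proof -
  have "f ^^ n holomorphic_on UNIV"
  proof (induction n)
    case 0
    then show ?case by (simp add: id_def)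
  next
    case (Suc n)
    then show ?case
      using holomorphic_on_compose_gen[OF Suc assms] by (simp add: o_def)
  qed
  then show ?thesis by (rule holomorphic_on_subset) auto
qed

text \<open>
  Schottky's theorem after an affine change of variable in source and target.  What matters is the
  uniformity: the bound depends only on the separation and the size of the two omitted values, so
  the omitted pair may change from function to function.
\<close>

lemma Schottky_two_values:
  fixes c C A :: real
  assumes "c > 0"
  obtains T where
    "\<And>g w R a b v. \<lbrakk>g holomorphic_on cball w R; R > 0;
        \<And>u. u \<in> cball w R \<Longrightarrow> g u \<noteq> a \<and> g u \<noteq> b; c \<le> cmod (a - b);
        cmod a \<le> C; cmod b \<le> C; cmod (g w) \<le> A; v \<in> cball w (R/2)\<rbrakk> \<Longrightarrow> cmod (g v) \<le> T"
proof
  define r where "r = (A + C) / c"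
  define S where "S = exp (pi * exp (pi * (2 + 2 * r + 12 * (1/2) / (1 - 1/2))))"
  fix g :: "complex \<Rightarrow> complex" and w a b v :: complex and R :: real
  assume hol: "g holomorphic_on cball w R" and R: "R > 0"
    and omit: "\<And>u. u \<in> cball w R \<Longrightarrow> g u \<noteq> a \<and> g u \<noteq> b"
    and ab: "c \<le> cmod (a - b)" "cmod a \<le> C" "cmod b \<le> C"
    and gw: "cmod (g w) \<le> A" and v: "v \<in> cball w (R/2)"
  have ne: "b \<noteq> a" using ab assms by auto
  define h where "h = (\<lambda>\<zeta>::complex. (g (w + R * \<zeta>) - a) / (b - a))"
  have mem: "w + R * \<zeta> \<in> cball w R" if "\<zeta> \<in> cball 0 1" for \<zeta> :: complex
  proof -
    have "cmod (w - (w + R * \<zeta>)) = R * cmod \<zeta>"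
      using R by (simp add: norm_mult)
    then show ?thesis
      using that R mult_left_mono[of "cmod \<zeta>" 1 R] by (simp add: dist_norm)
  qed
  have "(g \<circ> (\<lambda>\<zeta>. w + R * \<zeta>)) holomorphic_on cball 0 1"
    by (rule holomorphic_on_compose_gen[OF _ hol]) (use mem in \<open>auto intro!: holomorphic_intros\<close>)
  then have holh: "h holomorphic_on cball 0 1"
    unfolding h_def o_def by (intro holomorphic_intros) (use ne in auto)
  have h0: "cmod (h 0) \<le> r"
  proof -
    have "cmod (g w - a) \<le> A + C"
      using norm_triangle_ineq4[of "g w" a] gw ab by linarith
    then have "cmod (g w - a) / cmod (b - a) \<le> (A + C) / c"
      using ab assms by (intro frac_le) (auto simp: norm_minus_commute intro: order_trans[OF norm_ge_zero])
    then show ?thesis by (simp add: h_def r_def norm_divide)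
  qed
  have hne: "\<not> (h \<zeta> = 0 \<or> h \<zeta> = 1)" if "\<zeta> \<in> cball 0 1" for \<zeta>
    using omit[OF mem[OF that]] ne by (auto simp: h_def)
  define \<zeta> where "\<zeta> = (v - w) / R"
  have \<zeta>: "cmod \<zeta> \<le> 1/2"
    using v R by (simp add: \<zeta>_def norm_divide dist_norm norm_minus_commute field_simps)
  have "cmod (h \<zeta>) \<le> S"
    unfolding S_def by (rule Schottky[OF holh h0 hne _ _ \<zeta>]) auto
  moreover have "g v = a + (b - a) * h \<zeta>"
    using R ne by (simp add: h_def \<zeta>_def)
  ultimately have "cmod (g v) \<le> cmod a + cmod (b - a) * S"
    by (metis norm_triangle_le norm_mult add_left_mono mult_left_mono norm_ge_zero)
  also have "\<dots> \<le> C + (2 * C) * S"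
  proof (intro add_mono mult_right_mono)
    show "cmod (b - a) \<le> 2 * C"
      using norm_triangle_ineq4[of b a] ab by linarith
  qed (use ab in \<open>auto simp: S_def\<close>)
  finally show "cmod (g v) \<le> C + (2 * C) * S" .
qed

text \<open>
  The hypothesis says that smallness of an iterate at one point of the disc forces a bound on the
  whole disc.  A sequence of iterates whose values at the centre stay bounded along a subsequence is
  then handled by Montel's theorem for bounded families, and any other sequence tends to infinity
  at the centre, hence uniformly.  The finitely many iterates below $n_0$ are bounded on the disc
  anyway.
\<close>

lemma normal_iterates_if_uniformly_comparable:
  fixes f :: "complex \<Rightarrow> complex"
  assumes holf: "f holomorphic_on UNIV" and s: "s > 0"
    and comp: "\<And>A. \<exists>T. \<forall>n\<ge>n0. \<forall>v\<in>ball z s. \<forall>w\<in>ball z s.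
                 cmod ((f ^^ n) w) \<le> A \<longrightarrow> cmod ((f ^^ n) v) \<le> T"
  shows "z \<notin> Julia_set f"
proof -
  let ?U = "ball z s"
  have comp': "\<exists>T. \<forall>n. \<forall>v\<in>?U. \<forall>w\<in>?U. cmod ((f ^^ n) w) \<le> A \<longrightarrow> cmod ((f ^^ n) v) \<le> T" for A
  proof -
    obtain T where T: "\<And>n v w. \<lbrakk>n \<ge> n0; v \<in> ?U; w \<in> ?U; cmod ((f ^^ n) w) \<le> A\<rbrakk> \<Longrightarrow> cmod ((f ^^ n) v) \<le> T"
      using comp[of A] by blast
    have "\<exists>B. \<forall>v\<in>cball z s. cmod ((f ^^ n) v) \<le> B" for n
    proof -
      have "compact ((f ^^ n) ` cball z s)"
        by (intro compact_continuous_image holomorphic_on_imp_continuous_on holomorphic_on_compow holf) auto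
      then show ?thesis
        by (meson bounded_iff compact_imp_bounded imageI)
    qed
    then obtain B where B: "\<And>n v. v \<in> cball z s \<Longrightarrow> cmod ((f ^^ n) v) \<le> B n"
      by metis
    define T' where "T' = Max (insert T (B ` {..<n0}))"
    have "cmod ((f ^^ n) v) \<le> T'" if "v \<in> ?U" "w \<in> ?U" "cmod ((f ^^ n) w) \<le> A" for n v w
    proof (cases "n \<ge> n0")
      case True
      then show ?thesis using T[OF True that] by (auto simp: T'_def intro: order_trans[OF _ Max_ge])
    next
      case False
      have "cmod ((f ^^ n) v) \<le> B n" using B that by auto
      also have "\<dots> \<le> T'" using False by (auto simp: T'_def)
      finally show ?thesis .
    qed
    then show ?thesis by blast
  qed
  have "normal_family_on ?U (range (\<lambda>n. f ^^ n))"
    unfolding normal_family_on_def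
  proof (intro allI impI)
    fix F :: "nat \<Rightarrow> complex \<Rightarrow> complex"
    assume F: "range F \<subseteq> range (\<lambda>n. f ^^ n)"
    then have "\<exists>n. F i = f ^^ n" for i by blast
    then obtain m where m: "\<And>i. F i = f ^^ m i" by metis
    show "\<exists>r :: nat \<Rightarrow> nat. strict_mono r \<and>
           ((\<exists>g. g holomorphic_on ?U \<and> locally_uniform_limit ?U (F \<circ> r) g) \<or>
            locally_uniform_limit_infinity ?U (F \<circ> r))"
    proof (cases "\<exists>A. infinite {i. cmod (F i z) \<le> A}")
      case True
      then obtain A where inf: "infinite {i. cmod (F i z) \<le> A}" by blast
      obtain k :: "nat \<Rightarrow> nat" where k: "strict_mono k" "\<And>i. k i \<in> {i. cmod (F i z) \<le> A}"
        using infinite_enumerate[OF inf] by blast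
      obtain T where T: "\<And>n v w. \<lbrakk>v \<in> ?U; w \<in> ?U; cmod ((f ^^ n) w) \<le> A\<rbrakk> \<Longrightarrow> cmod ((f ^^ n) v) \<le> T"
        using comp'[of A] by blast
      obtain g r where gr: "g holomorphic_on ?U" "strict_mono (r :: nat \<Rightarrow> nat)"
        "\<And>K. \<lbrakk>compact K; K \<subseteq> ?U\<rbrakk> \<Longrightarrow> uniform_limit K ((F \<circ> k) \<circ> r) g sequentially"
      proof (rule Montel[of ?U "range (F \<circ> k)" "F \<circ> k"])
        show "h holomorphic_on ?U" if "h \<in> range (F \<circ> k)" for h
          using that by (auto simp: m intro: holomorphic_on_compow[OF holf])
        show "\<exists>B. \<forall>h\<in>range (F \<circ> k). \<forall>v\<in>K. cmod (h v) \<le> B" if "compact K" "K \<subseteq> ?U" for K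
        proof (intro exI ballI)
          fix h v assume "h \<in> range (F \<circ> k)" "v \<in> K"
          then show "cmod (h v) \<le> T"
            using T[of v z] k(2) that s by (auto simp: m)
        qed
      qed auto
      show ?thesis
      proof (intro exI conjI disjI1)
        show "strict_mono (k \<circ> r)" using k gr by (simp add: strict_mono_o)
        show "g holomorphic_on ?U" by fact
        show "locally_uniform_limit ?U (F \<circ> (k \<circ> r)) g"
          using gr(3) by (simp add: locally_uniform_limit_def o_assoc)
      qed
    next
      case False
      show ?thesis
      proof (intro exI[of _ id] conjI disjI2)
        show "locally_uniform_limit_infinity ?U (F \<circ> id)"
          unfolding locally_uniform_limit_infinity_def
        proof (intro allI impI)
          fix K B assume K: "compact K \<and> K \<subseteq> ?U"
          obtain T where T: "\<And>n v w. \<lbrakk>v \<in> ?U; w \<in> ?U; cmod ((f ^^ n) w) \<le> B\<rbrakk> \<Longrightarrow> cmod ((f ^^ n) v) \<le> T"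
            using comp'[of B] by blast
          have "finite {i. cmod (F i z) \<le> T}" using False by blast
          then have "\<forall>\<^sub>F i in sequentially. \<not> cmod (F i z) \<le> T"
            by (simp add: eventually_cofinite flip: cofinite_eq_sequentially)
          then show "\<forall>\<^sub>F n in sequentially. \<forall>z\<in>K. B < cmod ((F \<circ> id) n z)"
          proof eventually_elim
            case (elim i)
            then show ?case using T[of z _ "m i"] K s by (force simp: m not_le)
          qed
        qed
      qed (auto simp: strict_mono_def)
    qed
  qed
  then show ?thesis
    using s unfolding Julia_set_def by (auto intro!: exI[of _ ?U])
qed

text \<open>
  Montel's theorem with omitted values that may depend on the iterate.  If all late iterates omitted
  one of these pairs, Schottky's theorem would make their values at nearby points comparable.
\<close>

lemma Julia_hits_moving_pair:
  fixes f :: "complex \<Rightarrow> complex" and a b :: "nat \<Rightarrow> complex"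
  assumes holf: "f holomorphic_on UNIV" and z: "z \<in> Julia_set f" and r: "r > 0"
    and c: "c > 0" "\<And>n. c \<le> cmod (a n - b n)"
    and C: "\<And>n. cmod (a n) \<le> C" "\<And>n. cmod (b n) \<le> C"
  shows "\<exists>n\<ge>n0. a n \<in> (f ^^ n) ` ball z r \<or> b n \<in> (f ^^ n) ` ball z r"
proof (rule ccontr)
  assume neg: "\<not> ?thesis"
  define s where "s = r / 6"
  have s: "s > 0" using r by (simp add: s_def)
  have "z \<notin> Julia_set f"
  proof (rule normal_iterates_if_uniformly_comparable[OF holf s])
    fix A
    obtain T where T: "\<And>g w R a b v. \<lbrakk>g holomorphic_on cball w R; R > 0;
        \<And>u. u \<in> cball w R \<Longrightarrow> g u \<noteq> a \<and> g u \<noteq> b; c \<le> cmod (a - b);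
        cmod a \<le> C; cmod b \<le> C; cmod (g w) \<le> A; v \<in> cball w (R/2)\<rbrakk> \<Longrightarrow> cmod (g v) \<le> T"
      using Schottky_two_values[OF c(1), where C=C and A=A] by metis
    show "\<exists>T. \<forall>n\<ge>n0. \<forall>v\<in>ball z s. \<forall>w\<in>ball z s. cmod ((f ^^ n) w) \<le> A \<longrightarrow> cmod ((f ^^ n) v) \<le> T"
    proof (intro exI allI ballI impI)
      fix n v w assume n: "n0 \<le> n" and vw: "v \<in> ball z s" "w \<in> ball z s" and A: "cmod ((f ^^ n) w) \<le> A"
      \<comment> \<open>The radius \<open>s = r / 6\<close> is such that Schottky's theorem on a disc of radius \<open>4 s\<close> around \<open>w\<close> reaches all of the ball of radius \<open>s\<close>.\<close>
      have sub: "cball w (4 * s) \<subseteq> ball z r"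
      proof
        fix u assume "u \<in> cball w (4 * s)"
        then show "u \<in> ball z r"
          using vw dist_triangle[of z u w] r by (auto simp: s_def)
      qed
      show "cmod ((f ^^ n) v) \<le> T"
      proof (rule T[of "f ^^ n" w "4 * s" "a n" "b n"])
        show "v \<in> cball w (4 * s / 2)"
          using vw dist_triangle3[of w v z] by auto
        show "(f ^^ n) u \<noteq> a n \<and> (f ^^ n) u \<noteq> b n" if "u \<in> cball w (4 * s)" for u
          using neg n that sub by (metis image_eqI subsetD)
      qed (use A s c C holomorphic_on_compow[OF holf] in auto)
    qed
  qed
  with z show False by simp
qed

lemma Julia_hits_one_of_two:
  fixes f :: "complex \<Rightarrow> complex"
  assumes holf: "f holomorphic_on UNIV" and z: "z \<in> Julia_set f" and r: "r > 0" and ab: "a \<noteq> b"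
  shows "\<exists>n\<ge>n0. a \<in> (f ^^ n) ` ball z r \<or> b \<in> (f ^^ n) ` ball z r"
  using Julia_hits_moving_pair[OF holf z r, of "cmod (a - b)" "\<lambda>_. a" "\<lambda>_. b" "max (cmod a) (cmod b)"] ab
  by auto


section \<open>Growth of iterates of a transcendental entire function\<close>

lemma transcendental_entire_not_polynomial_sum:
  assumes "transcendental_entire f"
  shows "\<not> (\<forall>z. f z = (\<Sum>k\<le>n. a k * z ^ k))"
proof
  assume "\<forall>z. f z = (\<Sum>k\<le>n. a k * z ^ k)"
  then have "\<forall>z. f z = poly (\<Sum>k\<le>n. monom (a k) k) z"
    by (simp add: poly_sum poly_monom)
  then show False using assms unfolding transcendental_entire_def by blast
qed

lemma transcendental_entire_coefficient:
  assumes f: "transcendental_entire f"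
  shows "\<exists>n>K. (deriv ^^ n) f 0 \<noteq> 0"
proof (rule ccontr)
  assume neg: "\<not> ?thesis"
  have hol: "f holomorphic_on UNIV" using f by (simp add: transcendental_entire_def)
  have "f z = (\<Sum>k\<le>K. (deriv ^^ k) f 0 / fact k * z ^ k)" for z
  proof -
    have "(\<lambda>n. (deriv ^^ n) f 0 / fact n * (z - 0) ^ n) sums f z"
      by (rule holomorphic_power_series[of f 0 "cmod z + 1"]) (use hol holomorphic_on_subset in auto)
    moreover have "(\<lambda>n. (deriv ^^ n) f 0 / fact n * (z - 0) ^ n) sums
        (\<Sum>n\<le>K. (deriv ^^ n) f 0 / fact n * (z - 0) ^ n)"
      by (rule sums_finite) (use neg in \<open>auto simp: not_le\<close>)
    ultimately show ?thesis by (simp add: sums_unique2)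
  qed
  then show False
    using transcendental_entire_not_polynomial_sum[OF f, of "\<lambda>k. (deriv ^^ k) f 0 / fact k" K] by blast
qed

text \<open>
  Infinitely many Taylor coefficients are nonzero, and Cauchy's inequality for one of index above
  $K$ bounds the maximum modulus from below at every large radius, not just along a sequence.
\<close>

lemma transcendental_entire_exceeds_power:
  assumes f: "transcendental_entire f" and C: "C > 0"
  obtains R where "R \<ge> 1" "\<And>r. r \<ge> R \<Longrightarrow> \<exists>z. cmod z = r \<and> cmod (f z) > C * r ^ K"
proof -
  have hol: "f holomorphic_on UNIV" using f by (simp add: transcendental_entire_def)
  obtain n where n: "n > K" "(deriv ^^ n) f 0 \<noteq> 0"
    using transcendental_entire_coefficient[OF f] by blast
  define d where "d = cmod ((deriv ^^ n) f 0)"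
  have d: "d > 0" using n by (simp add: d_def)
  define R where "R = max 1 (fact n * C / d + 1)"
  show ?thesis
  proof
    show "R \<ge> 1" by (simp add: R_def)
    fix r assume r: "r \<ge> R"
    then have r1: "r \<ge> 1" "r > fact n * C / d" by (auto simp: R_def)
    show "\<exists>z. cmod z = r \<and> cmod (f z) > C * r ^ K"
    proof (rule ccontr)
      assume neg: "\<not> ?thesis"
      have "d \<le> fact n * (C * r ^ K) / r ^ n"
        unfolding d_def
        by (rule Cauchy_inequality)
          (use neg hol r1 in \<open>auto simp: not_less intro: holomorphic_on_imp_continuous_on holomorphic_on_subset\<close>)
      then have "d * r ^ n \<le> fact n * C * r ^ K"
        using r1 by (simp add: field_simps)
      moreover have "d * r * r ^ K \<le> d * r ^ n"
        using power_increasing[of "Suc K" n r] n r1 d by (simp add: mult.assoc)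
      ultimately have "d * r * r ^ K \<le> fact n * C * r ^ K" by linarith
      then have "d * r \<le> fact n * C" using r1 by (simp add: mult_le_cancel_right)
      then show False using r1 d by (simp add: field_simps)
    qed
  qed
qed

text \<open>
  If neither the circle of radius $r^K$ nor the one of twice that radius lay in the image of the
  disc, then $f/r^K$ would omit two values that are bounded and well separated, and Schottky's
  theorem would bound $f$ by a multiple of $r^K$ on a smaller disc, against its growth.
\<close>

lemma transcendental_entire_image_contains_circle:
  assumes f: "transcendental_entire f"
  obtains R where "R \<ge> 3" "\<And>r. r \<ge> R \<Longrightarrow> \<exists>\<rho>\<ge>r ^ K. sphere 0 \<rho> \<subseteq> f ` ball 0 r"
proof -
  have hol: "f holomorphic_on UNIV" using f by (simp add: transcendental_entire_def)
  obtain T where T: "\<And>g w R a b v. \<lbrakk>g holomorphic_on cball w R; R > 0;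
        \<And>u. u \<in> cball w R \<Longrightarrow> g u \<noteq> a \<and> g u \<noteq> b; 1 \<le> cmod (a - b);
        cmod a \<le> 2; cmod b \<le> 2; cmod (g w) \<le> 1 + cmod (f 0); v \<in> cball w (R/2)\<rbrakk> \<Longrightarrow> cmod (g v) \<le> T"
    using Schottky_two_values[of 1, where C=2 and A="1 + cmod (f 0)"] zero_less_one by metis
  obtain R0 where R0: "R0 \<ge> 1" "\<And>r. r \<ge> R0 \<Longrightarrow> \<exists>z. cmod z = r \<and> cmod (f z) > (\<bar>T\<bar> + 1) * 4 ^ K * r ^ K"
    using transcendental_entire_exceeds_power[OF f, of "(\<bar>T\<bar> + 1) * 4 ^ K" K] by (auto simp: pos_add_strict)
  show ?thesis
  proof
    show "max 3 (4 * R0) \<ge> 3" by simp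
    fix r assume r: "r \<ge> max 3 (4 * R0)"
    define \<rho> where "\<rho> = r ^ K"
    have \<rho>: "\<rho> \<ge> 1" using r by (simp add: \<rho>_def)
    show "\<exists>\<rho>\<ge>r ^ K. sphere 0 \<rho> \<subseteq> f ` ball 0 r"
    proof (rule ccontr)
      assume neg: "\<not> ?thesis"
      have "\<not> sphere 0 \<rho> \<subseteq> f ` ball 0 r" using neg \<rho>_def by auto
      then obtain a where a: "cmod a = \<rho>" "a \<notin> f ` ball 0 r" by (force simp: subset_iff)
      have "\<not> sphere 0 (2 * \<rho>) \<subseteq> f ` ball 0 r" using neg \<rho>_def \<rho> by auto
      then obtain b where b: "cmod b = 2 * \<rho>" "b \<notin> f ` ball 0 r" by (force simp: subset_iff)
      obtain z where z: "cmod z = r / 4" "cmod (f z) > (\<bar>T\<bar> + 1) * 4 ^ K * (r / 4) ^ K"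
        using R0(2)[of "r/4"] r by auto
      have "cmod (f z / \<rho>) \<le> T"
      proof (rule T[of "\<lambda>z. f z / \<rho>" 0 "r/2" "a / \<rho>" "b / \<rho>" z])
        show "(\<lambda>z. f z / \<rho>) holomorphic_on cball 0 (r/2)"
          using \<rho> by (intro holomorphic_intros holomorphic_on_subset[OF hol]) auto
        show "f u / \<rho> \<noteq> a / \<rho> \<and> f u / \<rho> \<noteq> b / \<rho>" if "u \<in> cball 0 (r/2)" for u
          using that a b \<rho> r by (auto simp: image_iff)
        have "cmod (a / \<rho> - b / \<rho>) = cmod (b - a) / \<rho>"
          using \<rho> by (simp add: norm_divide norm_minus_commute flip: diff_divide_distrib)
        moreover have "cmod (b - a) \<ge> \<rho>"
          using norm_triangle_ineq2[of b a] a b by simp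
        ultimately show "1 \<le> cmod (a / \<rho> - b / \<rho>)" using \<rho> by simp
        have "cmod (f 0) / \<rho> \<le> cmod (f 0) / 1"
          by (rule divide_left_mono) (use \<rho> in auto)
        then show "cmod (f 0 / \<rho>) \<le> 1 + cmod (f 0)"
          using \<rho> by (simp add: norm_divide)
      qed (use a b \<rho> z r in \<open>auto simp: norm_divide\<close>)
      then have "cmod (f z) \<le> T * \<rho>"
        using \<rho> by (simp add: norm_divide field_simps)
      also have "\<dots> \<le> (\<bar>T\<bar> + 1) * \<rho>" using \<rho> by (intro mult_right_mono) auto
      also have "\<dots> = (\<bar>T\<bar> + 1) * 4 ^ K * (r / 4) ^ K" by (simp add: \<rho>_def power_divide)
      finally show False using z by simp
    qed
  qed
qed

lemma entire_circle_beats_disc: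
  assumes hol: "f holomorphic_on UNIV" and z: "cmod z \<le> r" "M \<le> cmod (f z)"
  shows "\<exists>w. cmod w = r \<and> M \<le> cmod (f w)"
proof -
  have "r \<ge> 0" using z norm_ge_zero order_trans by blast
  have "compact (sphere (0::complex) r)" "sphere (0::complex) r \<noteq> {}"
    using \<open>r \<ge> 0\<close> by auto
  moreover have "continuous_on (sphere 0 r) (\<lambda>w. cmod (f w))"
    by (intro continuous_intros holomorphic_on_imp_continuous_on holomorphic_on_subset[OF hol]) auto
  ultimately obtain w where w: "w \<in> sphere 0 r" "\<And>u. u \<in> sphere 0 r \<Longrightarrow> cmod (f u) \<le> cmod (f w)"
    using continuous_attains_sup by metis
  have "cmod (f z) \<le> cmod (f w)"
  proof (rule maximum_modulus_frontier[of f "cball 0 r"])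
    show "continuous_on (closure (cball 0 r)) f" "f holomorphic_on interior (cball 0 r)"
      using hol by (auto intro: holomorphic_on_imp_continuous_on holomorphic_on_subset)
  qed (use w z in auto)
  then show ?thesis using w z by (intro exI[of _ w]) auto
qed

text \<open>
  The image of a disc of radius $r$ contains a whole circle of radius at least $r^K$, and on that
  circle the remaining iterates attain, by induction, the size claimed for their own start radius.
  Only one application of $f$ is peeled off at a time, so no radius has to shrink with $n$.
\<close>

lemma iterates_superexponential_on_circles:
  assumes f: "transcendental_entire f" and K: "K \<ge> 1"
  obtains R where "R \<ge> 3"
    "\<And>n r. r \<ge> R \<Longrightarrow> \<exists>w. cmod w = r \<and> r ^ (K ^ n) \<le> cmod ((f ^^ n) w)"
proof -
  have hol: "f holomorphic_on UNIV" using f by (simp add: transcendental_entire_def)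
  obtain R where R: "R \<ge> 3" "\<And>r. r \<ge> R \<Longrightarrow> \<exists>\<rho>\<ge>r ^ K. sphere 0 \<rho> \<subseteq> f ` ball 0 r"
    using transcendental_entire_image_contains_circle[OF f] by metis
  have "\<exists>w. cmod w = r \<and> r ^ (K ^ n) \<le> cmod ((f ^^ n) w)" if "r \<ge> R" for n r
    using that
  proof (induction n arbitrary: r)
    case 0
    then show ?case using R(1) by (intro exI[of _ "of_real r"]) auto
  next
    case (Suc n)
    obtain \<rho> where \<rho>: "\<rho> \<ge> r ^ K" "sphere 0 \<rho> \<subseteq> f ` ball 0 r" using R(2)[OF Suc.prems] by blast
    have "r ^ 1 \<le> r ^ K" using Suc.prems R(1) K by (intro power_increasing) auto
    then have "\<rho> \<ge> R" using \<rho> Suc.prems by simp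
    then obtain w where w: "cmod w = \<rho>" "\<rho> ^ (K ^ n) \<le> cmod ((f ^^ n) w)" using Suc.IH by blast
    then obtain z where z: "cmod z < r" "w = f z" using \<rho>(2) by auto
    have "r ^ (K ^ Suc n) = (r ^ K) ^ (K ^ n)" by (simp add: power_mult)
    also have "\<dots> \<le> \<rho> ^ (K ^ n)" using \<rho> Suc.prems R(1) by (intro power_mono) auto
    also have "\<dots> \<le> cmod ((f ^^ Suc n) z)" using w z by (simp add: funpow_swap1)
    finally show ?case
      using entire_circle_beats_disc[OF holomorphic_on_compow[OF hol], of z r _ "Suc n"] z by simp
  qed
  with R(1) show ?thesis using that by blast
qed


section \<open>Large values force large derivatives; rescaling\<close>

text \<open>
  Harnack's inequality for the positive harmonic function $\log|g|$.  It comes from the Schwarz lemma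
  applied to the composition of a branch of $\log g$ with a Moebius map that takes the right half-plane
  to the disc and its value at the centre to $0$.
\<close>

lemma Harnack_for_log_modulus:
  assumes hol: "g holomorphic_on ball 0 1" and big: "\<And>z. z \<in> ball 0 1 \<Longrightarrow> 1 < cmod (g z)"
    and t: "0 \<le> t" "t < 1"
  shows "ln (cmod (g 0)) * (1 - t) / (1 + t) \<le> ln (cmod (g (of_real t)))"
proof -
  obtain h where holh: "h holomorphic_on ball 0 1" and gh: "\<And>z. z \<in> ball 0 1 \<Longrightarrow> g z = exp (h z)"
    using contractible_imp_holomorphic_log[OF hol] big
    by (metis convex_ball convex_imp_contractible norm_zero not_one_less_zero)
  have Re: "Re (h z) = ln (cmod (g z))" if "z \<in> ball 0 1" for z
    using gh[OF that] by simp
  have Re0: "Re (h z) > 0" if "z \<in> ball 0 1" for z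
    using Re[OF that] ln_gt_zero[OF big[OF that]] by simp
  define c where "c = h 0"
  have c: "Re c > 0" using Re0[of 0] by (simp add: c_def)
  have nz: "h z + cnj c \<noteq> 0" if "z \<in> ball 0 1" for z
    using Re0[OF that] c by (auto simp: complex_eq_iff)
  define \<phi> where "\<phi> = (\<lambda>z. (h z - c) / (h z + cnj c))"
  have "cmod (\<phi> (of_real t)) \<le> cmod (of_real t)"
  proof (rule Schwarz_Lemma(1))
    show "\<phi> holomorphic_on ball 0 1"
      unfolding \<phi>_def by (intro holomorphic_intros holh) (use nz in auto)
    show "\<phi> 0 = 0" by (simp add: \<phi>_def c_def)
    show "cmod (\<phi> z) < 1" if "cmod z < 1" for z
    proof -
      have z: "z \<in> ball 0 1" using that by simp
      have "(cmod (h z - c))\<^sup>2 < (cmod (h z + cnj c))\<^sup>2"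
        using Re0[OF z] c unfolding cmod_power2 by (simp add: power2_eq_square algebra_simps)
      then have "cmod (h z - c) < cmod (h z + cnj c)"
        by (rule power2_less_imp_less) auto
      then show ?thesis using nz[OF z] by (simp add: \<phi>_def norm_divide)
    qed
  qed (use t in auto)
  moreover have tb: "complex_of_real t \<in> ball 0 1" using t by simp
  ultimately have "cmod (h t - c) \<le> t * cmod (h t + cnj c)"
    using t nz[OF tb] by (simp add: \<phi>_def norm_divide field_simps)
  then have "(cmod (h t - c))\<^sup>2 \<le> (t * cmod (h t + cnj c))\<^sup>2"
    by (rule power_mono) auto
  then have *: "(Re (h t) - Re c)\<^sup>2 + (Im (h t) - Im c)\<^sup>2 \<le>
      t\<^sup>2 * ((Re (h t) + Re c)\<^sup>2 + (Im (h t) - Im c)\<^sup>2)"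
    unfolding power_mult_distrib cmod_power2 by simp
  \<comment> \<open>Dropping the imaginary parts preserves the estimate, because \<open>t < 1\<close>.\<close>
  have "t\<^sup>2 * (Im (h t) - Im c)\<^sup>2 \<le> 1 * (Im (h t) - Im c)\<^sup>2"
    using t by (intro mult_right_mono) (auto simp: power_le_one)
  then have "(Re (h t) - Re c)\<^sup>2 \<le> t\<^sup>2 * (Re (h t) + Re c)\<^sup>2"
    using * unfolding distrib_left by linarith
  then have "(Re (h t) - Re c)\<^sup>2 \<le> (t * (Re (h t) + Re c))\<^sup>2"
    by (simp only: power_mult_distrib)
  then have "\<bar>Re (h t) - Re c\<bar> \<le> \<bar>t * (Re (h t) + Re c)\<bar>"
    by (simp only: abs_le_square_iff)
  moreover have "t * (Re (h t) + Re c) \<ge> 0" using t Re0[OF tb] c by simp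
  ultimately have "Re c * (1 - t) \<le> Re (h t) * (1 + t)" by (simp add: algebra_simps)
  then have "Re c * (1 - t) / (1 + t) \<le> Re (h t)" using t by (simp add: field_simps)
  then show ?thesis using Re[OF tb] Re[of 0] by (simp add: c_def)
qed

text \<open>
  The Hopf boundary point lemma for $\log|F|$: by Harnack's inequality, $\log|F|$ rises at least
  linearly, with slope proportional to its value at the centre, when one moves from the boundary
  point $q$ towards the centre, and $\log|F(q)| \le 0$.
\<close>

lemma derivative_at_edge_of_large_disc:
  assumes hol: "F holomorphic_on UNIV" and d: "d > 0"
    and big: "\<And>v. v \<in> ball w d \<Longrightarrow> 1 < cmod (F v)"
    and q: "dist w q = d" "cmod (F q) \<le> 1"
  shows "ln (cmod (F w)) / (2 * d) \<le> cmod (deriv F q)"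
proof -
  define g where "g = (\<lambda>\<zeta>. F (w + (q - w) * \<zeta>))"
  define L where "L = ln (cmod (F w))"
  have L: "L > 0" using ln_gt_zero[OF big[of w]] d by (simp add: L_def)
  have "F field_differentiable at q"
    using hol by (simp add: holomorphic_on_open field_differentiable_def)
  then have "(F has_field_derivative deriv F q) (at q)"
    by (simp add: field_differentiable_derivI)
  then have "(g has_field_derivative deriv F q * (q - w)) (at 1)"
    unfolding g_def by (auto intro!: derivative_eq_intros DERIV_chain2[where f=F])
  then have lim: "((\<lambda>\<zeta>. (g \<zeta> - g 1) / (\<zeta> - 1)) \<longlongrightarrow> deriv F q * (q - w)) (at 1)"
    by (simp add: has_field_derivative_iff)
  \<comment> \<open>Difference quotients of \<open>g\<close> along the radius that ends at the boundary point \<open>1\<close>.\<close>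
  define x where "x = (\<lambda>n::nat. 1 - 1 / of_nat (Suc n) :: real)"
  have x: "0 \<le> x n" "x n < 1" for n by (auto simp: x_def)
  have "(\<lambda>n. complex_of_real (x n)) \<longlonglongrightarrow> complex_of_real (1 - 0)"
    unfolding x_def by (intro tendsto_intros LIMSEQ_Suc[OF lim_1_over_n])
  then have "filterlim (\<lambda>n. complex_of_real (x n)) (at 1) sequentially"
    using x(2) by (auto simp: filterlim_at less_imp_neq)
  then have "(\<lambda>n. (g (x n) - g 1) / (x n - 1)) \<longlonglongrightarrow> deriv F q * (q - w)"
    using filterlim_compose[OF lim] by simp
  then have "(\<lambda>n. cmod ((g (x n) - g 1) / (x n - 1))) \<longlonglongrightarrow> cmod (deriv F q * (q - w))"
    by (rule tendsto_norm)
  moreover have "L / 2 \<le> cmod ((g (x n) - g 1) / (x n - 1))" for n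
  proof -
    let ?t = "x n"
    have mem: "w + (q - w) * z \<in> ball w d" if "z \<in> ball 0 1" for z
    proof -
      have "cmod (q - w) = d" using q by (simp add: dist_norm norm_minus_commute)
      then show ?thesis using that d by (simp add: dist_norm norm_mult)
    qed
    have "(F \<circ> (\<lambda>\<zeta>. w + (q - w) * \<zeta>)) holomorphic_on ball 0 1"
      by (intro holomorphic_on_compose_gen[OF _ hol] holomorphic_intros) auto
    then have "g holomorphic_on ball 0 1" by (simp add: g_def o_def)
    then have "ln (cmod (g 0)) * (1 - ?t) / (1 + ?t) \<le> ln (cmod (g ?t))"
      by (rule Harnack_for_log_modulus) (use big mem x in \<open>auto simp: g_def\<close>)
    then have "L * (1 - ?t) / (1 + ?t) \<le> ln (cmod (g ?t))" by (simp add: g_def L_def)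
    moreover have "L * (1 - ?t) / 2 \<le> L * (1 - ?t) / (1 + ?t)"
      by (rule divide_left_mono) (use L x[of n] in auto)
    moreover have "1 < cmod (g ?t)"
      using big[OF mem[of ?t]] x[of n] by (simp add: g_def)
    then have "ln (cmod (g ?t)) \<le> cmod (g ?t) - 1"
      by (intro ln_le_minus_one) auto
    ultimately have "L * (1 - ?t) / 2 \<le> cmod (g ?t) - 1" by linarith
    also have "\<dots> \<le> cmod (g ?t) - cmod (g 1)" using q by (simp add: g_def)
    also have "\<dots> \<le> cmod (g ?t - g 1)" by (rule norm_triangle_ineq2)
    finally have "L / 2 \<le> cmod (g ?t - g 1) / (1 - ?t)" using x[of n] by (simp add: field_simps)
    also have "1 - ?t = cmod (x n - 1)"
    proof -
      have "cmod (complex_of_real (x n - 1)) = 1 - ?t" using x[of n] by (simp only: norm_of_real)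
      then show ?thesis by simp
    qed
    finally show ?thesis by (simp add: norm_divide)
  qed
  ultimately have "L / 2 \<le> cmod (deriv F q * (q - w))"
    by (intro tendsto_lowerbound[where F=sequentially]) auto
  also have "\<dots> = cmod (deriv F q) * d" using q by (simp add: norm_mult dist_norm norm_minus_commute)
  finally show ?thesis using d by (simp add: L_def field_simps)
qed

text \<open>
  The point of $\{|F| \le 1\}$ nearest to $z_1$ lies on the boundary of a disc around $z_1$ where
  $|F| > 1$.  The estimate turns the large value $|F(z_1)|$ into a large derivative at a point where
  $|F|$ is under control; read the other way, a bound on $F'$ over $\{|F| \le 1\}$ gives an
  exponential bound on $F$ itself.
\<close>

lemma large_derivative_where_bounded_by_one:
  assumes hol: "F holomorphic_on UNIV"
    and z0: "cmod (F z0) \<le> 1" and z1: "1 < cmod (F z1)"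
  obtains q where "cmod (F q) \<le> 1" "dist z1 q \<le> dist z1 z0"
    "ln (cmod (F z1)) / (2 * dist z1 z0) \<le> cmod (deriv F q)"
proof -
  have cont: "continuous_on UNIV (\<lambda>z. cmod (F z))"
    by (intro continuous_intros holomorphic_on_imp_continuous_on hol)
  then have "closed {z. cmod (F z) \<le> 1}"
    by (intro closed_Collect_le) auto
  then obtain q where q: "cmod (F q) \<le> 1" "\<And>y. cmod (F y) \<le> 1 \<Longrightarrow> dist z1 q \<le> dist z1 y"
    using distance_attains_inf[of "{z. cmod (F z) \<le> 1}" z1] z0 by auto
  define d where "d = dist z1 q"
  have d: "d > 0" using q z1 by (auto simp: d_def)
  have "ln (cmod (F z1)) / (2 * d) \<le> cmod (deriv F q)"
  proof (rule derivative_at_edge_of_large_disc[OF hol d])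
    show "1 < cmod (F v)" if "v \<in> ball z1 d" for v
      using q(2)[of v] that by (auto simp: d_def not_le[symmetric])
  qed (use q d_def in auto)
  moreover have "ln (cmod (F z1)) / (2 * dist z1 z0) \<le> ln (cmod (F z1)) / (2 * d)"
    using q(2)[OF z0] d z1 by (intro divide_left_mono mult_pos_pos) (auto simp: d_def)
  ultimately show ?thesis using that q z0 by force
qed

text \<open>
  A version of Zalcman's rescaling that never leaves the finite plane.  The quantity
  $(6e - |z - p|)\,|F'(z)|$ is maximised only over the part of the disc where $|F| \le 1$.  At the
  maximum $q$, the rescaled function $\zeta \mapsto F(q + \rho\zeta)$ has a derivative of size at most
  $2$ wherever it is bounded by $1$, and the preceding lemma then bounds it by
  $e^{4|\zeta|}$ on a disc whose radius is proportional to $L$.  So the functions rescaled with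
  $L \to \infty$ form a locally bounded family, to which Montel's theorem for bounded families
  applies.  The larger $\log|F(z_1)|$ is, the smaller the scale $\rho$.
\<close>

lemma rescaling_point:
  assumes hol: "F holomorphic_on UNIV" and e: "e > 0" and L: "L > 0"
    and z0: "z0 \<in> ball p e" "cmod (F z0) \<le> 1" and z1: "z1 \<in> ball p e" "L \<le> ln (cmod (F z1))"
  obtains q \<rho> where "dist p q < 6 * e" "0 < \<rho>" "\<rho> \<le> 8 * e / L" "cmod (deriv F q) * \<rho> = 1"
    "\<And>\<zeta>. cmod \<zeta> \<le> 3 * L / 16 \<Longrightarrow> cmod (F (q + \<rho> * \<zeta>)) \<le> exp (4 * cmod \<zeta>)"
proof -
  have z1': "1 < cmod (F z1)"
  proof (rule ccontr)
    assume "\<not> 1 < cmod (F z1)"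
    then have "ln (cmod (F z1)) \<le> 0" by (cases "F z1 = 0") auto
    then show False using z1 L by linarith
  qed
  obtain q1 where q1: "cmod (F q1) \<le> 1" "dist z1 q1 \<le> dist z1 z0"
    "ln (cmod (F z1)) / (2 * dist z1 z0) \<le> cmod (deriv F q1)"
    using large_derivative_where_bounded_by_one[OF hol z0(2) z1'] by blast
  have d01: "0 < dist z1 z0" "dist z1 z0 \<le> 2 * e"
    using z0 z1 z1' dist_triangle3[of z1 z0 p] by auto
  have "L / (4 * e) \<le> ln (cmod (F z1)) / (2 * dist z1 z0)"
    using z1 L d01 e by (intro frac_le) auto
  with q1 have q1': "L / (4 * e) \<le> cmod (deriv F q1)" by linarith
  have q1p: "dist p q1 \<le> 3 * e"
    using q1(2) d01 z1 dist_triangle[of p q1 z1] by auto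
  define A where "A = {z \<in> cball p (6 * e). cmod (F z) \<le> 1}"
  define m where "m = (\<lambda>z. (6 * e - dist p z) * cmod (deriv F z))"
  have contF: "continuous_on S F" "continuous_on S (deriv F)" for S
    by (auto intro!: holomorphic_on_imp_continuous_on holomorphic_on_subset[OF hol]
        holomorphic_on_subset[OF holomorphic_deriv[OF hol]])
  have "closed {z. cmod (F z) \<le> 1}"
    by (intro closed_Collect_le continuous_intros contF)
  then have "compact A"
    using compact_Int_closed[OF compact_cball, of "{z. cmod (F z) \<le> 1}" p "6 * e"]
    by (simp add: A_def Int_def)
  moreover have "A \<noteq> {}" using q1 q1p e by (auto simp: A_def intro!: exI[of _ q1])
  moreover have "continuous_on A m" unfolding m_def by (intro continuous_intros contF)
  ultimately obtain q where q: "q \<in> A" "\<And>z. z \<in> A \<Longrightarrow> m z \<le> m q"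
    using continuous_attains_sup by metis
  define \<delta> where "\<delta> = 6 * e - dist p q"
  have "3 * L / 4 = (3 * e) * (L / (4 * e))" using e by simp
  also have "\<dots> \<le> m q1" unfolding m_def using q1p q1' e L by (intro mult_mono) auto
  also have "\<dots> \<le> m q" by (rule q(2)) (use q1 q1p e in \<open>auto simp: A_def\<close>)
  \<comment> \<open>The point \<open>q1\<close> makes the maximum proportional to \<open>L\<close>.\<close>
  finally have mq: "3 * L / 4 \<le> \<delta> * cmod (deriv F q)" by (simp add: m_def \<delta>_def)
  have "\<delta> * cmod (deriv F q) > 0" using mq L by linarith
  moreover have "\<delta> \<ge> 0" using q by (auto simp: A_def \<delta>_def)
  ultimately have \<delta>: "\<delta> > 0" and D: "cmod (deriv F q) > 0"
    by (auto simp: zero_less_mult_iff)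
  define \<rho> where "\<rho> = 1 / cmod (deriv F q)"
  have \<rho>: "\<rho> > 0" using D by (simp add: \<rho>_def)
  have \<delta>\<rho>: "3 * L / 4 * \<rho> \<le> \<delta>" using mq D by (simp add: \<rho>_def field_simps)
  show ?thesis
  proof
    show "dist p q < 6 * e" using \<delta> by (simp add: \<delta>_def)
    show "0 < \<rho>" by fact
    have "\<delta> \<le> 6 * e" by (simp add: \<delta>_def)
    then have "3 * L / 4 * \<rho> \<le> 6 * e" using \<delta>\<rho> by linarith
    then show "\<rho> \<le> 8 * e / L" using L by (simp add: field_simps)
    show "cmod (deriv F q) * \<rho> = 1" using D by (simp add: \<rho>_def)
    fix \<zeta> assume \<zeta>: "cmod \<zeta> \<le> 3 * L / 16"
    let ?z = "q + \<rho> * \<zeta>"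
    show "cmod (F ?z) \<le> exp (4 * cmod \<zeta>)"
    proof (cases "cmod (F ?z) \<le> 1")
      case True
      also have "1 \<le> exp (4 * cmod \<zeta>)" by simp
      finally show ?thesis .
    next
      case False
      have Fq: "cmod (F q) \<le> 1" using q by (simp add: A_def)
      obtain u where u: "cmod (F u) \<le> 1" "dist ?z u \<le> dist ?z q"
        "ln (cmod (F ?z)) / (2 * dist ?z q) \<le> cmod (deriv F u)"
        using large_derivative_where_bounded_by_one[OF hol Fq, of ?z] False by (auto simp: not_le)
      have dz: "dist ?z q = \<rho> * cmod \<zeta>" using \<rho> by (simp add: dist_norm norm_mult)
      have pos: "\<rho> * cmod \<zeta> > 0" using False Fq \<rho> by (cases "\<zeta> = 0") auto
      have "dist q u \<le> 2 * (\<rho> * cmod \<zeta>)"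
        using u(2) dz dist_triangle3[of q u ?z] by linarith
      also have "\<dots> \<le> 2 * (\<rho> * (3 * L / 16))" using \<zeta> \<rho> by (intro mult_left_mono) auto
      also have "\<dots> \<le> \<delta> / 2" using \<delta>\<rho> by simp
      finally have qu: "dist p u \<le> 6 * e - \<delta> / 2"
        using dist_triangle[of p u q] \<delta>_def by linarith
      then have "u \<in> A" using u \<delta> by (auto simp: A_def)
      then have "m u \<le> \<delta> * cmod (deriv F q)" using q(2) by (simp add: m_def \<delta>_def)
      moreover have "\<delta> / 2 * cmod (deriv F u) \<le> m u"
        unfolding m_def using qu by (intro mult_right_mono) auto
      ultimately have "\<delta> / 2 * cmod (deriv F u) \<le> \<delta> * cmod (deriv F q)" by linarith
      then have "cmod (deriv F u) \<le> 2 * cmod (deriv F q)" using \<delta> by simp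
      then have "ln (cmod (F ?z)) / (2 * (\<rho> * cmod \<zeta>)) \<le> 2 / \<rho>"
        using u(3) dz by (simp add: \<rho>_def)
      then have "ln (cmod (F ?z)) \<le> 4 * cmod \<zeta>"
      proof -
        have "ln (cmod (F ?z)) \<le> 2 / \<rho> * (2 * (\<rho> * cmod \<zeta>))"
          using \<open>ln (cmod (F ?z)) / (2 * (\<rho> * cmod \<zeta>)) \<le> 2 / \<rho>\<close> pos
          by (simp only: pos_divide_le_eq mult_pos_pos zero_less_numeral)
        then show ?thesis using \<rho> by simp
      qed
      moreover have "cmod (F ?z) > 0" using False by linarith
      ultimately show ?thesis by (metis exp_le_cancel_iff exp_ln)
    qed
  qed
qed


section \<open>The essential singularity at infinity\<close>

lemma transcendental_entire_not_pole_at_infinity: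
  assumes f: "transcendental_entire f"
  shows "\<not> ((\<lambda>z. inverse (f z - c)) \<longlongrightarrow> l) at_infinity"
proof
  assume lim: "((\<lambda>z. inverse (f z - c)) \<longlongrightarrow> l) at_infinity"
  have hol: "f holomorphic_on UNIV" using f by (simp add: transcendental_entire_def)
  have "(\<lambda>z. f z - c) holomorphic_on UNIV" by (intro holomorphic_intros hol)
  then obtain a n where a: "\<And>z. f z - c = (\<Sum>i\<le>n. a i * z ^ i)"
    using pole_at_infinity[of "\<lambda>z. f z - c" l] lim by (auto simp: o_def)
  have "f z = poly ((\<Sum>i\<le>n. monom (a i) i) + [:c:]) z" for z
    using a[of z] by (simp add: poly_sum poly_monom algebra_simps)
  then show False using f unfolding transcendental_entire_def by blast
qed

lemma transcendental_entire_not_linear_growth: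
  assumes f: "transcendental_entire f"
  shows "\<not> (\<forall>\<^sub>F z in at_infinity. cmod (f z) \<le> B * cmod z)"
proof
  assume "\<forall>\<^sub>F z in at_infinity. cmod (f z) \<le> B * cmod z"
  then obtain A where "\<And>z. A \<le> cmod z \<Longrightarrow> cmod (f z) \<le> B * cmod z ^ 1"
    by (auto simp: eventually_at_infinity)
  then have "\<forall>z. f z = (\<Sum>k\<le>1. (deriv ^^ k) f 0 / fact k * z ^ k)"
    using Liouville_polynomial[of f A B 1] f unfolding transcendental_entire_def by blast
  then show False
    using transcendental_entire_not_polynomial_sum[OF f, of "\<lambda>k. (deriv ^^ k) f 0 / fact k" 1] by blast
qed

text \<open>
  The great Picard theorem at infinity, transported to $0$ by inversion.
\<close>

lemma transcendental_entire_infinite_preimages: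
  assumes f: "transcendental_entire f"
  obtains a where "\<And>w. w \<noteq> a \<Longrightarrow> infinite {z. f z = w}"
proof -
  have hol: "f holomorphic_on UNIV" using f by (simp add: transcendental_entire_def)
  have 1: "(f \<circ> inverse) holomorphic_on UNIV - {0}"
    by (intro holomorphic_on_compose_gen[OF _ hol] holomorphic_intros) auto
  have 2: "\<not> ((f \<circ> inverse) \<longlongrightarrow> l) (at 0)" for l
  proof
    assume "((f \<circ> inverse) \<longlongrightarrow> l) (at 0)"
    then have "(f \<longlongrightarrow> l) at_infinity" by (simp add: lim_at_infinity_0)
    then have "f z = l" for z using Liouville_weak[OF hol] by blast
    then have "\<forall>z. f z = poly [:l:] z" by simp
    then show False using f unfolding transcendental_entire_def by blast
  qed
  have 3: "\<not> ((inverse \<circ> (f \<circ> inverse)) \<longlongrightarrow> l) (at 0)" for l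
    using transcendental_entire_not_pole_at_infinity[OF f, of 0 l]
    by (simp add: lim_at_infinity_0 o_def)
  obtain a where a: "\<And>w. w \<noteq> a \<Longrightarrow> infinite {x. x \<in> UNIV - {0} \<and> (f \<circ> inverse) x = w}"
    using great_Picard_infinite[OF open_UNIV UNIV_I 1 2 3] by blast
  show ?thesis
  proof
    fix w assume "w \<noteq> a"
    have "inj_on inverse {x. x \<in> UNIV - {0} \<and> (f \<circ> inverse) x = w}"
      by (auto simp: inj_on_def)
    then have "infinite (inverse ` {x. x \<in> UNIV - {0} \<and> (f \<circ> inverse) x = w})"
      using a[OF \<open>w \<noteq> a\<close>] finite_image_iff by blast
    then show "infinite {z. f z = w}"
      by (rule infinite_super[rotated]) auto
  qed
qed

text \<open>
  The quotient $(f(z) - c)/(z - c)$ omits $0$ near infinity.  If it also omitted $1$, it would have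
  a finite or infinite limit at infinity by the great Picard theorem, and $f$ would be a polynomial.
\<close>

lemma transcendental_entire_fixed_point:
  assumes f: "transcendental_entire f" and omit: "\<And>z. z \<noteq> c \<Longrightarrow> f z \<noteq> c"
  obtains z where "z \<noteq> c" "f z = z"
proof (rule ccontr)
  assume neg: "\<not> thesis"
  have nofix: "f z \<noteq> z" if "z \<noteq> c" for z
    using neg that \<open>\<And>z. \<lbrakk>z \<noteq> c; f z = z\<rbrakk> \<Longrightarrow> thesis\<close> by blast
  have hol: "f holomorphic_on UNIV" using f by (simp add: transcendental_entire_def)
  define q where "q = (\<lambda>z. (f z - c) / (z - c))"
  define M where "M = ball (0::complex) (1 / (cmod c + 1))"
  have M: "inverse w \<noteq> c" if "w \<in> M - {0}" for w
  proof
    assume "inverse w = c"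
    then have "c * w = 1" using that by auto
    then have "cmod c * cmod w = 1" by (metis norm_mult norm_one)
    moreover have "cmod w * (cmod c + 1) < 1"
      using that by (simp add: M_def field_simps add_pos_nonneg)
    ultimately show False by (simp add: algebra_simps)
  qed
  have "(q \<circ> inverse) holomorphic_on M - {0}"
    unfolding q_def o_def
  proof (intro holomorphic_intros)
    show "(\<lambda>w. f (inverse w)) holomorphic_on M - {0}"
      by (intro holomorphic_on_compose_gen[OF _ hol, unfolded o_def] holomorphic_intros) auto
  qed (use M in auto)
  moreover have "(q \<circ> inverse) w \<noteq> 0 \<and> (q \<circ> inverse) w \<noteq> 1" if "w \<in> M - {0}" for w
    using M[OF that] omit[OF M[OF that]] nofix[OF M[OF that]] by (simp add: q_def)
  moreover have "open M" "0 \<in> M" by (auto simp: M_def add_nonneg_pos)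
  ultimately obtain l where "((q \<circ> inverse) \<longlongrightarrow> l) (at 0) \<or> ((inverse \<circ> (q \<circ> inverse)) \<longlongrightarrow> l) (at 0)"
    using great_Picard[of M 0 0 1 "q \<circ> inverse"] zero_neq_one by metis
  then have lim: "(q \<longlongrightarrow> l) at_infinity \<or> ((\<lambda>z. inverse (q z)) \<longlongrightarrow> l) at_infinity"
    by (simp add: lim_at_infinity_0 o_def)
  have no: "\<not> (q \<longlongrightarrow> l) at_infinity" for l
  proof
    assume "(q \<longlongrightarrow> l) at_infinity"
    then have "\<forall>\<^sub>F z in at_infinity. dist (q z) l < 1" by (rule tendstoD) simp
    moreover have "\<forall>\<^sub>F z in at_infinity. cmod z \<ge> cmod c + 1"
      by (auto simp: eventually_at_infinity)
    ultimately have "\<forall>\<^sub>F z in at_infinity. cmod (f z) \<le> (cmod c + (cmod l + 1) * 2) * cmod z"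
    proof eventually_elim
      case (elim z)
      have "z \<noteq> c" using elim by auto
      have "cmod (q z) \<le> cmod l + 1"
        using elim norm_triangle_ineq2[of "q z" l] by (simp add: dist_norm)
      then have "cmod (f z - c) \<le> (cmod l + 1) * cmod (z - c)"
        using \<open>z \<noteq> c\<close> by (simp add: q_def norm_divide field_simps)
      also have "\<dots> \<le> (cmod l + 1) * (2 * cmod z)"
        using elim norm_triangle_ineq4[of z c] by (intro mult_left_mono) auto
      finally have "cmod (f z) \<le> cmod c + (cmod l + 1) * (2 * cmod z)"
        using norm_triangle_ineq2[of "f z" c] by linarith
      moreover have "cmod c * 1 \<le> cmod c * cmod z" using elim norm_ge_zero[of c] by (intro mult_left_mono) linarith+
      ultimately show ?case by (simp add: algebra_simps)
    qed
    then show False using transcendental_entire_not_linear_growth[OF f] by blast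
  qed
  with lim have lim': "((\<lambda>z. inverse (q z)) \<longlongrightarrow> l) at_infinity" by blast
  show False
  proof (cases "l = 0")
    case False
    then have "(q \<longlongrightarrow> inverse l) at_infinity"
      using tendsto_inverse[OF lim'] by simp
    with no show False by blast
  next
    case True
    have "((\<lambda>z. inverse (f z - c)) \<longlongrightarrow> 0) at_infinity"
    proof (rule Lim_null_comparison)
      show "((\<lambda>z. cmod (inverse (q z))) \<longlongrightarrow> 0) at_infinity"
        using tendsto_norm_zero[OF lim'[unfolded True]] .
      have "\<forall>\<^sub>F z in at_infinity. cmod z \<ge> cmod c + 1"
        by (auto simp: eventually_at_infinity)
      then show "\<forall>\<^sub>F z in at_infinity. cmod (inverse (f z - c)) \<le> cmod (inverse (q z))"
      proof eventually_elim
        case (elim z)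
        then have "1 \<le> cmod (z - c)" using norm_triangle_ineq2[of z c] by linarith
        then have "1 / cmod (f z - c) \<le> cmod (z - c) / cmod (f z - c)"
          by (intro divide_right_mono) auto
        then show ?case by (simp add: q_def norm_divide inverse_eq_divide)
      qed
    qed
    with transcendental_entire_not_pole_at_infinity[OF f] show False by blast
  qed
qed

section \<open>The Julia set is perfect\<close>

lemma closed_Julia_set: "closed (Julia_set f)"
proof -
  have "open (- Julia_set f)"
    unfolding open_subopen[of "- Julia_set f"]
  proof
    fix z assume "z \<in> - Julia_set f"
    then obtain U where U: "open U" "connected U" "z \<in> U" "normal_family_on U (range (\<lambda>n. f ^^ n))"
      unfolding Julia_set_def by blast
    then have "U \<subseteq> - Julia_set f" unfolding Julia_set_def by blast
    with U show "\<exists>T. open T \<and> z \<in> T \<and> T \<subseteq> - Julia_set f" by blast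
  qed
  then show ?thesis by (simp add: closed_def)
qed

lemma transcendental_entire_nonconstant:
  assumes f: "transcendental_entire f"
  shows "\<not> f constant_on UNIV"
proof
  assume "f constant_on UNIV"
  then obtain c where "\<forall>z. f z = poly [:c:] z" by (auto simp: constant_on_def)
  then show False using f unfolding transcendental_entire_def by blast
qed

lemma compact_subset_of_open_image:
  fixes f :: "complex \<Rightarrow> complex"
  assumes openf: "\<And>V. open V \<Longrightarrow> open (f ` V)" and U: "open U"
    and K: "compact K" "K \<subseteq> f ` U"
  obtains K' where "compact K'" "K' \<subseteq> U" "K \<subseteq> f ` K'"
proof -
  have "\<exists>x e. e > 0 \<and> cball x e \<subseteq> U \<and> f x = y" if "y \<in> K" for y
  proof -
    obtain x where "x \<in> U" "f x = y" using K \<open>y \<in> K\<close> by auto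
    then show ?thesis using U open_contains_cball by metis
  qed
  then obtain x e where xe: "\<And>y. y \<in> K \<Longrightarrow> e y > 0 \<and> cball (x y) (e y) \<subseteq> U \<and> f (x y) = y"
    by metis
  have "y \<in> f ` ball (x y) (e y)" if "y \<in> K" for y
    using xe[OF that] by (intro image_eqI[of _ _ "x y"]) auto
  then have "K \<subseteq> (\<Union>y\<in>K. f ` ball (x y) (e y))" by blast
  then obtain I where I: "I \<subseteq> K" "finite I" "K \<subseteq> (\<Union>y\<in>I. f ` ball (x y) (e y))"
    by (rule compactE_image[OF K(1), of K "\<lambda>y. f ` ball (x y) (e y)", rotated]) (auto intro: openf)
  show ?thesis
  proof
    show "compact (\<Union>y\<in>I. cball (x y) (e y))" using I by (intro compact_UN) auto
    show "(\<Union>y\<in>I. cball (x y) (e y)) \<subseteq> U" using I xe by blast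
    show "K \<subseteq> f ` (\<Union>y\<in>I. cball (x y) (e y))" 
    proof
      fix y assume "y \<in> K"
      then obtain i where i: "i \<in> I" "y \<in> f ` ball (x i) (e i)" using I(3) by blast
      then have "y \<in> f ` cball (x i) (e i)" using ball_subset_cball by blast
      with i(1) show "y \<in> f ` (\<Union>y\<in>I. cball (x y) (e y))" by blast
    qed
  qed
qed

text \<open>
  If the iterates are normal on $U$, they are normal on $f(U)$: for a sequence $F_i$ of iterates, the
  functions $F_i \circ f$ are again iterates and converge on $U$ along a subsequence.  Every compact
  subset of $f(U)$ is covered by the image of a compact subset of $U$, so the convergence descends.
\<close>

lemma Fatou_forward_invariant:
  assumes f: "transcendental_entire f" and z: "z \<notin> Julia_set f"
  shows "f z \<notin> Julia_set f"
proof -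
  have hol: "f holomorphic_on UNIV" using f by (simp add: transcendental_entire_def)
  have openf: "open (f ` V)" if "open V" for V
    using open_mapping_thm[OF hol open_UNIV connected_UNIV that] transcendental_entire_nonconstant[OF f] by auto
  obtain U where U: "open U" "connected U" "z \<in> U" "normal_family_on U (range (\<lambda>n. f ^^ n))"
    using z unfolding Julia_set_def by blast
  have contf: "continuous_on U f"
    using hol holomorphic_on_imp_continuous_on holomorphic_on_subset by blast
  have "normal_family_on (f ` U) (range (\<lambda>n. f ^^ n))"
    unfolding normal_family_on_def
  proof (intro allI impI)
    fix F :: "nat \<Rightarrow> complex \<Rightarrow> complex"
    assume F: "range F \<subseteq> range (\<lambda>n. f ^^ n)"
    then have "\<exists>n. F i = f ^^ n" for i by blast
    then obtain m where m: "\<And>i. F i = f ^^ m i" by metis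
    define F' where "F' = (\<lambda>i. f ^^ Suc (m i))"
    have F': "F' i z = F i (f z)" for i z by (simp add: F'_def m funpow_swap1)
    have "range F' \<subseteq> range (\<lambda>n. f ^^ n)" by (auto simp: F'_def simp del: funpow.simps)
    then obtain r :: "nat \<Rightarrow> nat" where r: "strict_mono r"
      "(\<exists>g. g holomorphic_on U \<and> locally_uniform_limit U (F' \<circ> r) g) \<or>
        locally_uniform_limit_infinity U (F' \<circ> r)"
      using U(4) unfolding normal_family_on_def by blast
    show "\<exists>r :: nat \<Rightarrow> nat. strict_mono r \<and>
           ((\<exists>g. g holomorphic_on f ` U \<and> locally_uniform_limit (f ` U) (F \<circ> r) g) \<or>
            locally_uniform_limit_infinity (f ` U) (F \<circ> r))"
      using r(2)
    proof
      assume "\<exists>g. g holomorphic_on U \<and> locally_uniform_limit U (F' \<circ> r) g"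
      then obtain g where g: "\<And>K. compact K \<Longrightarrow> K \<subseteq> U \<Longrightarrow> uniform_limit K (F' \<circ> r) g sequentially"
        unfolding locally_uniform_limit_def by blast
      define G where "G = (\<lambda>y. lim (\<lambda>i. (F \<circ> r) i y))"
      have G: "G (f x) = g x" if "x \<in> U" for x
      proof -
        have "uniform_limit {x} (F' \<circ> r) g sequentially" by (rule g) (use that in auto)
        then have "(\<lambda>i. (F' \<circ> r) i x) \<longlonglongrightarrow> g x" by (rule tendsto_uniform_limitI) simp
        then show ?thesis unfolding G_def by (intro limI) (simp add: F')
      qed
      have ul: "uniform_limit K (F \<circ> r) G sequentially" if K: "compact K" "K \<subseteq> f ` U" for K
      proof -
        obtain K' where K': "compact K'" "K' \<subseteq> U" "K \<subseteq> f ` K'"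
          using compact_subset_of_open_image[OF openf U(1) K] by blast
        show ?thesis
          unfolding uniform_limit_iff
        proof (intro allI impI)
          fix e :: real assume "e > 0"
          then have "\<forall>\<^sub>F n in sequentially. \<forall>x\<in>K'. dist ((F' \<circ> r) n x) (g x) < e"
            using g[OF K'(1,2)] by (simp add: uniform_limit_iff)
          then show "\<forall>\<^sub>F n in sequentially. \<forall>x\<in>K. dist ((F \<circ> r) n x) (G x) < e"
          proof eventually_elim
            case (elim n)
            show ?case
            proof
              fix y assume "y \<in> K"
              then obtain x where x: "x \<in> K'" "y = f x" using K'(3) by blast
              then show "dist ((F \<circ> r) n y) (G y) < e"
                using bspec[OF elim x(1)] G[of x] K'(2) by (auto simp: F')
            qed
          qed
        qed
      qed
      have "G holomorphic_on f ` U"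
      proof (rule holomorphic_uniform_sequence[OF openf[OF U(1)]])
        show "(F \<circ> r) n holomorphic_on f ` U" for n
          by (simp add: m holomorphic_on_compow[OF hol])
        show "\<exists>d>0. cball x d \<subseteq> f ` U \<and> uniform_limit (cball x d) (F \<circ> r) G sequentially"
          if "x \<in> f ` U" for x
        proof -
          obtain d where "d > 0" "cball x d \<subseteq> f ` U"
            using open_contains_cball_eq[OF openf[OF U(1)]] \<open>x \<in> f ` U\<close> by blast
          then show ?thesis using ul[OF compact_cball] by blast
        qed
      qed
      with ul show ?thesis using r(1) unfolding locally_uniform_limit_def by blast
    next
      assume inf: "locally_uniform_limit_infinity U (F' \<circ> r)"
      have "locally_uniform_limit_infinity (f ` U) (F \<circ> r)"
        unfolding locally_uniform_limit_infinity_def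
      proof (intro allI impI)
        fix K B assume K: "compact K \<and> K \<subseteq> f ` U"
        obtain K' where K': "compact K'" "K' \<subseteq> U" "K \<subseteq> f ` K'"
          using compact_subset_of_open_image[OF openf U(1)] K by blast
        have "\<forall>\<^sub>F n in sequentially. \<forall>z\<in>K'. B < cmod ((F' \<circ> r) n z)"
          using inf K' unfolding locally_uniform_limit_infinity_def by blast
        then show "\<forall>\<^sub>F n in sequentially. \<forall>z\<in>K. B < cmod ((F \<circ> r) n z)"
        proof eventually_elim
          case (elim n)
          show ?case
          proof
            fix y assume "y \<in> K"
            then obtain x where x: "x \<in> K'" "y = f x" using K'(3) by blast
            then show "B < cmod ((F \<circ> r) n y)"
              using bspec[OF elim x(1)] by (simp add: F')
          qed
        qed
      qed
      then show ?thesis using r(1) by blast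
    qed
  qed
  moreover have "open (f ` U)" "connected (f ` U)" "f z \<in> f ` U"
    using openf U contf by (auto intro: connected_continuous_image)
  ultimately show ?thesis unfolding Julia_set_def by blast
qed

lemma Fatou_forward_invariant_iterate:
  assumes "transcendental_entire f" "z \<notin> Julia_set f"
  shows "(f ^^ n) z \<notin> Julia_set f"
  by (induction n) (use assms Fatou_forward_invariant in auto)


text \<open>
  One bounded orbit in a domain of normality rules out the limit $\infty$ for every sequence of
  iterates.
\<close>

lemma normal_bounded_orbit_locally_bounded:
  fixes f :: "complex \<Rightarrow> complex"
  assumes U: "normal_family_on U (range (\<lambda>n. f ^^ n))" and s: "s \<in> U"
    and B: "\<And>n. cmod ((f ^^ n) s) \<le> B" and K: "compact K" "K \<subseteq> U"
  shows "\<exists>C. \<forall>n. \<forall>v\<in>K. cmod ((f ^^ n) v) \<le> C"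
proof (rule ccontr)
  assume "\<not> ?thesis"
  then have "\<exists>n v. v \<in> K \<and> real i < cmod ((f ^^ n) v)" for i
    by (meson not_le)
  then obtain m v where mv: "\<And>i. v i \<in> K" "\<And>i. real i < cmod ((f ^^ m i) (v i))" by metis
  define F where "F = (\<lambda>i. f ^^ m i)"
  have "range F \<subseteq> range (\<lambda>n. f ^^ n)" by (auto simp: F_def)
  then obtain r :: "nat \<Rightarrow> nat" where r: "strict_mono r"
    "(\<exists>g. g holomorphic_on U \<and> locally_uniform_limit U (F \<circ> r) g) \<or>
        locally_uniform_limit_infinity U (F \<circ> r)"
    using U unfolding normal_family_on_def by blast
  show False
    using r(2)
  proof
    assume "\<exists>g. g holomorphic_on U \<and> locally_uniform_limit U (F \<circ> r) g"
    then obtain g where g: "g holomorphic_on U" "uniform_limit K (F \<circ> r) g sequentially"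
      using K unfolding locally_uniform_limit_def by blast
    have "continuous_on K g"
      using g(1) K(2) holomorphic_on_imp_continuous_on continuous_on_subset by blast
    then have "bounded (g ` K)" using K(1) compact_continuous_image compact_imp_bounded by blast
    then obtain C where C: "\<And>v. v \<in> K \<Longrightarrow> cmod (g v) \<le> C" by (auto simp: bounded_iff)
    have "\<forall>\<^sub>F i in sequentially. \<forall>v\<in>K. dist ((F \<circ> r) i v) (g v) < 1"
      using g(2) by (simp add: uniform_limit_iff)
    moreover have "\<forall>\<^sub>F i in sequentially. real i \<ge> C + 1"
      using filterlim_real_sequentially by (simp add: filterlim_at_top)
    ultimately have "\<forall>\<^sub>F i::nat in sequentially. False"
    proof eventually_elim
      case (elim i)
      have "dist (F (r i) (v (r i))) (g (v (r i))) < 1" using elim(1) mv(1) by auto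
      then have "cmod (F (r i) (v (r i))) < C + 1"
        using C[OF mv(1), of "r i"] norm_triangle_ineq2[of "F (r i) (v (r i))" "g (v (r i))"]
        by (simp add: dist_norm)
      moreover have "i \<le> r i" using r(1) by (rule seq_suble)
      ultimately show False using mv(2)[of "r i"] elim(2) by (simp add: F_def)
    qed
    then show False by simp
  next
    assume "locally_uniform_limit_infinity U (F \<circ> r)"
    then have "\<forall>\<^sub>F i in sequentially. \<forall>z\<in>{s}. B < cmod ((F \<circ> r) i z)"
      using s unfolding locally_uniform_limit_infinity_def by (metis compact_sing empty_subsetI insert_subset)
    then have "\<forall>\<^sub>F i::nat in sequentially. False"
      by eventually_elim (use B in \<open>auto simp: F_def not_less[symmetric]\<close>)
    then show False by simp
  qed
qed

text \<open>
  A fixed point $z_1 \ne c$ exists.  If the Julia set were $\{c\}$, the bounded orbit of $z_1$ would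
  make the iterates locally bounded on all of the connected set $\mathbb{C} \setminus \{c\}$, hence
  bounded on a circle around $c$ and, by the maximum principle, on the enclosed disc.  Then $c$ would not
  be in the Julia set.
\<close>

lemma Julia_set_not_omitted_singleton:
  assumes f: "transcendental_entire f" and omit: "\<And>z. z \<noteq> c \<Longrightarrow> f z \<noteq> c"
  shows "Julia_set f \<noteq> {c}"
proof
  assume J: "Julia_set f = {c}"
  have hol: "f holomorphic_on UNIV" using f by (simp add: transcendental_entire_def)
  obtain z1 where z1: "z1 \<noteq> c" "f z1 = z1" using transcendental_entire_fixed_point[OF f omit] by blast
  have fix1: "(f ^^ n) z1 = z1" for n by (induction n) (use z1 in auto)
  \<comment> \<open>The points where the iterates are locally uniformly bounded form an open and closed subset of the punctured plane.\<close>
  define S where "S = {w. w \<noteq> c \<and> (\<exists>V B. open V \<and> w \<in> V \<and> (\<forall>n. \<forall>v\<in>V. cmod ((f ^^ n) v) \<le> B))}"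
  have spread: "w \<in> S" if w: "w \<noteq> c" and near: "\<And>U. \<lbrakk>open U; w \<in> U\<rbrakk> \<Longrightarrow> \<exists>s\<in>U. \<exists>B. \<forall>n. cmod ((f ^^ n) s) \<le> B" for w
  proof -
    have "w \<notin> Julia_set f" using w J by simp
    then obtain U where U: "open U" "w \<in> U" "normal_family_on U (range (\<lambda>n. f ^^ n))"
      unfolding Julia_set_def by blast
    obtain s B where s: "s \<in> U" "\<And>n. cmod ((f ^^ n) s) \<le> B" using near[OF U(1,2)] by blast
    obtain e where e: "e > 0" "cball w e \<subseteq> U" using U open_contains_cball by blast
    obtain C where C: "\<And>n v. v \<in> cball w e \<Longrightarrow> cmod ((f ^^ n) v) \<le> C"
      using normal_bounded_orbit_locally_bounded[OF U(3) s compact_cball e(2)] by blast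
    have "open (ball w e) \<and> w \<in> ball w e \<and> (\<forall>n. \<forall>v\<in>ball w e. cmod ((f ^^ n) v) \<le> C)"
      using C e by auto
    then show ?thesis using w unfolding S_def by blast
  qed
  have "S = UNIV - {c}"
  proof (rule GPicard2)
    show "connected (UNIV - {c})"
      by (rule connected_open_delete) auto
    have "z1 \<in> S" by (rule spread[OF z1(1)]) (auto simp: fix1 intro!: bexI[of _ z1])
    then show "S \<noteq> {}" by blast
    show "open S"
      unfolding open_subopen[of S]
    proof
      fix w assume "w \<in> S"
      then obtain V B where "w \<noteq> c" "open V" "w \<in> V" "\<forall>n. \<forall>v\<in>V. cmod ((f ^^ n) v) \<le> B"
        unfolding S_def by blast
      then have "open (V - {c})" "w \<in> V - {c}" "V - {c} \<subseteq> S"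
        unfolding S_def by auto
      then show "\<exists>T. open T \<and> w \<in> T \<and> T \<subseteq> S" by blast
    qed
    show "x \<in> S" if x: "x islimpt S" "x \<in> UNIV - {c}" for x
    proof (rule spread)
      fix U assume "open U" "x \<in> U"
      then obtain s where "s \<in> S" "s \<in> U" using x(1) unfolding islimpt_def by blast
      then show "\<exists>s\<in>U. \<exists>B. \<forall>n. cmod ((f ^^ n) s) \<le> B" unfolding S_def by blast
    qed (use x in auto)
  qed (auto simp: S_def)
  then have "w \<in> S" if "w \<in> sphere c 1" for w
    using that by auto
  then have "\<forall>w\<in>sphere c 1. \<exists>V B. open V \<and> w \<in> V \<and> (\<forall>n. \<forall>v\<in>V. cmod ((f ^^ n) v) \<le> B)"
    unfolding S_def by blast
  then obtain V where V: "\<forall>w\<in>sphere c 1. \<exists>B. open (V w) \<and> w \<in> V w \<and> (\<forall>n. \<forall>v\<in>V w. cmod ((f ^^ n) v) \<le> B)"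
    by (rule bchoice[THEN exE])
  then obtain B where B: "\<forall>w\<in>sphere c 1. open (V w) \<and> w \<in> V w \<and> (\<forall>n. \<forall>v\<in>V w. cmod ((f ^^ n) v) \<le> B w)"
    by (rule bchoice[THEN exE])
  have cov: "sphere c 1 \<subseteq> (\<Union>w\<in>sphere c 1. V w)" using V by blast
  have "compact (sphere c 1)" by simp
  then obtain I where I: "I \<subseteq> sphere c 1" "finite I" "sphere c 1 \<subseteq> (\<Union>w\<in>I. V w)"
    by (rule compactE_image[of _ "sphere c 1" V]) (use V cov in auto)
  define C where "C = Max (B ` I)"
  have C: "cmod ((f ^^ n) v) \<le> C" if v: "v \<in> sphere c 1" for n v
  proof -
    obtain w where w: "w \<in> I" "v \<in> V w" using I v by blast
    then have "cmod ((f ^^ n) v) \<le> B w" using B I by blast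
    also have "\<dots> \<le> C" using I w by (simp add: C_def)
    finally show ?thesis .
  qed
  have C': "cmod ((f ^^ n) v) \<le> C" if v: "v \<in> ball c 1" for n v
  proof (rule maximum_modulus_frontier[of "f ^^ n" "cball c 1"])
    show "continuous_on (closure (cball c 1)) (f ^^ n)"
      using holomorphic_on_compow[OF hol] by (auto intro: holomorphic_on_imp_continuous_on)
  qed (use v C holomorphic_on_compow[OF hol] in auto)
  have "c \<notin> Julia_set f"
    by (rule normal_iterates_if_uniformly_comparable[OF hol, of 1 0])
      (auto intro!: exI[of _ C] C')
  with J show False by simp
qed

lemma finite_orbit:
  fixes f :: "'a \<Rightarrow> 'a"
  assumes "(f ^^ i) x = (f ^^ j) x" "i < j"
  shows "finite (range (\<lambda>n. (f ^^ n) x))"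
proof -
  have "(f ^^ n) x \<in> (\<lambda>n. (f ^^ n) x) ` {..<j}" for n
  proof (induction n rule: less_induct)
    case (less n)
    show ?case
    proof (cases "n < j")
      case False
      have "(f ^^ n) x = (f ^^ (n - j)) ((f ^^ j) x)"
        using False by (metis comp_apply funpow_add le_add_diff_inverse2 not_less)
      also have "\<dots> = (f ^^ (n - j + i)) x" using assms(1) by (simp add: funpow_add)
      finally show ?thesis using less[of "n - j + i"] False assms(2) by simp
    qed auto
  qed
  then have "range (\<lambda>n. (f ^^ n) x) \<subseteq> (\<lambda>n. (f ^^ n) x) ` {..<j}" by blast
  then show ?thesis using finite_subset by blast
qed

text \<open>
  Around an isolated point $z_0$, only $z_0$ itself can be mapped into the Julia set.  By Montel's
  theorem the Julia set is then contained in the orbit of $z_0$ together with one more point.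
  A point of the Julia set with infinitely many preimages would be visited infinitely often by that orbit,
  which would make the orbit, and with it the set of preimages, finite.  So all points of the Julia set have finitely
  many preimages, which the great Picard theorem allows for one point only.  The Julia set would be
  $\{z_0\}$, and no other point would be mapped to $z_0$, the case excluded before.
\<close>

lemma Julia_set_no_isolated_points:
  assumes f: "transcendental_entire f" and z0: "z0 \<in> Julia_set f"
  shows "z0 islimpt Julia_set f"
proof (rule ccontr)
  assume "\<not> ?thesis"
  then obtain r where r: "r > 0" "\<And>y. y \<in> Julia_set f \<Longrightarrow> dist y z0 < r \<Longrightarrow> y = z0"
    unfolding islimpt_approachable by blast
  have hol: "f holomorphic_on UNIV" using f by (simp add: transcendental_entire_def)
  define Orb where "Orb = range (\<lambda>n. (f ^^ n) z0)"
  have orb: "q \<in> Orb" if q: "q \<in> Julia_set f" "q \<in> (f ^^ n) ` ball z0 r" for q n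
  proof -
    obtain y where y: "y \<in> ball z0 r" "q = (f ^^ n) y" using q(2) by blast
    then have "y \<in> Julia_set f" using Fatou_forward_invariant_iterate[OF f] q(1) by blast
    then show ?thesis using r(2) y by (auto simp: Orb_def dist_commute)
  qed
  \<comment> \<open>By Montel's theorem the iterates of the ball around \<open>z0\<close> miss at most one value.\<close>
  have two: "q \<in> Orb \<or> q' \<in> Orb" if "q \<in> Julia_set f" "q' \<in> Julia_set f" "q \<noteq> q'" for q q'
    using Julia_hits_one_of_two[OF hol z0 r(1) that(3), of 0] orb that by blast
  obtain e where e: "Julia_set f \<subseteq> insert e Orb"
  proof (cases "Julia_set f \<subseteq> Orb")
    case False
    then obtain e where "e \<in> Julia_set f" "e \<notin> Orb" by blast
    then show ?thesis using that[of e] two by blast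
  qed (use that in blast)
  have fin: "finite {z. f z = q}" if q: "q \<in> Julia_set f" for q
  proof (rule ccontr)
    assume inf: "infinite {z. f z = q}"
    have "{z. f z = q} \<subseteq> Julia_set f" using Fatou_forward_invariant[OF f] q by blast
    then have sub: "{z. f z = q} \<subseteq> insert e Orb" using e by blast
    then have inf_orb: "infinite Orb" using inf finite_subset by blast
    have "{z. f z = q} - {e} \<subseteq> (\<lambda>m. (f ^^ m) z0) ` {m. (f ^^ Suc m) z0 = q}"
      using sub by (auto simp: Orb_def)
    then have "infinite {m. (f ^^ Suc m) z0 = q}"
      using inf by (meson finite_imageI finite_insert finite_subset infinite_remove)
    then obtain k :: "nat \<Rightarrow> nat" where k: "strict_mono k" "\<And>i. k i \<in> {m. (f ^^ Suc m) z0 = q}"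
      using infinite_enumerate by blast
    have "(f ^^ Suc (k 0)) z0 = (f ^^ Suc (k 1)) z0" using k(2)[of 0] k(2)[of 1] by simp
    moreover have "Suc (k 0) < Suc (k 1)" using k(1) by (simp add: strict_mono_def)
    ultimately have "finite Orb" unfolding Orb_def by (rule finite_orbit)
    with inf_orb show False by simp
  qed
  obtain a where a: "\<And>w. w \<noteq> a \<Longrightarrow> infinite {z. f z = w}"
    using transcendental_entire_infinite_preimages[OF f] by blast
  have J: "Julia_set f = {z0}"
  proof -
    have "q = a" if "q \<in> Julia_set f" for q using a[of q] fin[OF that] by blast
    then show ?thesis using z0 by blast
  qed
  have "f z \<noteq> z0" if "z \<noteq> z0" for z
    using Fatou_forward_invariant[OF f, of z] that J by auto
  then show False using Julia_set_not_omitted_singleton[OF f] J by blast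
qed

text \<open>
  Baire's theorem: in a closed set without isolated points, removing countably many points leaves a dense set.
\<close>

lemma uncountable_Julia_set_ball:
  assumes f: "transcendental_entire f" and p: "p \<in> Julia_set f" and r: "r > 0"
  shows "uncountable (Julia_set f \<inter> ball p r)"
proof
  let ?J = "Julia_set f"
  assume cnt: "countable (?J \<inter> ball p r)"
  define G where "G = (\<lambda>x. ?J - {x}) ` (?J \<inter> ball p r)"
  have "?J \<subseteq> closure (\<Inter>G)"
  proof (rule Baire)
    show "closed ?J" by (rule closed_Julia_set)
    show "countable G" using cnt by (simp add: G_def)
    fix T assume "T \<in> G"
    then obtain x where T: "T = ?J - {x}" by (auto simp: G_def)
    have "y \<in> closure T" if "y \<in> ?J" for y
    proof (cases "y = x")
      case True
      have "y islimpt (?J - {y})"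
        using islimpt_punctured[of y ?J] Julia_set_no_isolated_points[OF f that] by (rule iffD1)
      then show ?thesis unfolding T True[symmetric] closure_def by blast
    next
      case False
      then have "y \<in> T" using that T by blast
      then show ?thesis using closure_subset by blast
    qed
    moreover have "openin (top_of_set ?J) T" unfolding T by (rule openin_delete) simp
    ultimately show "openin (top_of_set ?J) T \<and> ?J \<subseteq> closure T" by blast
  qed
  then have "p \<in> closure (\<Inter>G)" using p by blast
  then have "\<exists>y\<in>\<Inter>G. dist y p < r" using r by (simp only: closure_approachable)
  then obtain y where "y \<in> \<Inter>G" "y \<in> ball p r" by (metis dist_commute mem_ball)
  moreover have "?J - {p} \<in> G" using p r by (auto simp: G_def)
  ultimately have "y \<in> ?J \<inter> ball p r" by blast
  then have "?J - {y} \<in> G" by (auto simp: G_def)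
  with \<open>y \<in> \<Inter>G\<close> show False by blast
qed


section \<open>Periodic points of large multiplier\<close>

lemma iterate_has_field_derivative:
  assumes "f holomorphic_on UNIV"
  shows "((f ^^ n) has_field_derivative deriv (f ^^ n) z) (at z)"
  using holomorphic_on_compow[OF assms, of n UNIV]
  by (simp add: holomorphic_on_open field_differentiable_def field_differentiable_derivI)

lemma entire_has_field_derivative:
  assumes "f holomorphic_on UNIV"
  shows "(f has_field_derivative deriv f z) (at z)"
  using assms by (simp add: holomorphic_on_open field_differentiable_def field_differentiable_derivI)

lemma deriv_iterate_add:
  assumes "f holomorphic_on UNIV"
  shows "deriv (f ^^ (m + n)) z = deriv (f ^^ m) ((f ^^ n) z) * deriv (f ^^ n) z"
proof -
  have "((f ^^ m) \<circ> (f ^^ n) has_field_derivative deriv (f ^^ m) ((f ^^ n) z) * deriv (f ^^ n) z) (at z)"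
    by (intro DERIV_chain iterate_has_field_derivative assms)
  then show ?thesis by (simp add: funpow_add DERIV_imp_deriv)
qed

lemma iterate_nonconstant:
  assumes f: "transcendental_entire f"
  shows "\<not> f ^^ n constant_on UNIV"
proof
  assume "f ^^ n constant_on UNIV"
  then obtain c where c: "\<And>z. (f ^^ n) z = c" by (auto simp: constant_on_def)
  obtain R where R: "R \<ge> 3"
    "\<And>n r. r \<ge> R \<Longrightarrow> \<exists>w. cmod w = r \<and> r ^ (1 ^ n) \<le> cmod ((f ^^ n) w)"
    using iterates_superexponential_on_circles[OF f, of 1] by auto
  show False
    using R(2)[of "max R (cmod c + 1)" n] c by auto
qed

lemma countable_critical_values:
  assumes hol: "g holomorphic_on UNIV" and nc: "\<not> g constant_on UNIV"
  shows "countable (g ` {z. deriv g z = 0})"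
proof -
  have hol': "deriv g holomorphic_on UNIV" using hol by (simp add: holomorphic_deriv)
  have "countable {z. deriv g z = 0}"
  proof (cases "deriv g constant_on UNIV")
    case False
    then show ?thesis using holomorphic_countable_zeros[OF hol' open_UNIV connected_UNIV] by simp
  next
    case True
    then obtain c where c: "\<And>z. deriv g z = c" by (auto simp: constant_on_def)
    have "c \<noteq> 0"
    proof
      assume "c = 0"
      then have "(g has_field_derivative 0) (at z)" for z
        using entire_has_field_derivative[OF hol, of z] c by simp
      then have "\<exists>c. \<forall>x\<in>UNIV. g x = c" by (intro has_field_derivative_zero_constant) auto
      with nc show False by (auto simp: constant_on_def)
    qed
    then show ?thesis using c by simp
  qed
  then show ?thesis by simp
qed

lemma deriv_difference_le:
  assumes hol: "g holomorphic_on UNIV" "h holomorphic_on UNIV" and s: "s > 0"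
    and close: "\<And>u. u \<in> cball z s \<Longrightarrow> cmod (g u - h u) \<le> \<eta>"
  shows "cmod (deriv g z - deriv h z) \<le> \<eta> / s"
proof -
  have "cmod ((deriv ^^ 1) (\<lambda>u. g u - h u) z) \<le> fact 1 * \<eta> / s ^ 1"
  proof (rule Cauchy_inequality[OF _ _ s])
    show "(\<lambda>u. g u - h u) holomorphic_on ball z s"
      by (intro holomorphic_intros holomorphic_on_subset[OF hol(1)] holomorphic_on_subset[OF hol(2)]) auto
    show "continuous_on (cball z s) (\<lambda>u. g u - h u)"
      by (intro continuous_intros holomorphic_on_imp_continuous_on holomorphic_on_subset[OF hol(1)]
          holomorphic_on_subset[OF hol(2)]) auto
  qed (use close in \<open>auto simp: dist_norm\<close>)
  moreover have "deriv (\<lambda>u. g u - h u) z = deriv g z - deriv h z"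
    by (intro DERIV_imp_deriv derivative_intros entire_has_field_derivative hol)
  ultimately show ?thesis by simp
qed

text \<open>
  Some iterate maps the disc over a large circle, on which later iterates grow like $e^{K^n}$ with any
  $K$ given in advance; taking $K > A$ absorbs the iterates needed to reach the circle.
  Since the iterates hit $0$ or $1$ infinitely often on the disc, small values occur there as well,
  at infinitely many of the same times.
\<close>

lemma Julia_explosion:
  assumes f: "transcendental_entire f" and p: "p \<in> Julia_set f" and e: "e > 0" and A: "A \<ge> 1"
  obtains n z0 z1 where "z0 \<in> ball p e" "z1 \<in> ball p e" "cmod ((f ^^ n) z0) \<le> 1"
    "real A ^ Suc n \<le> ln (cmod ((f ^^ n) z1))"
proof -
  have hol: "f holomorphic_on UNIV" using f by (simp add: transcendental_entire_def)
  \<comment> \<open>Any base above \<open>A\<close> works.\<close>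
  define K where "K = Suc A"
  obtain R where R: "R \<ge> 3"
    "\<And>n r. r \<ge> R \<Longrightarrow> \<exists>w. cmod w = r \<and> r ^ (K ^ n) \<le> cmod ((f ^^ n) w)"
    using iterates_superexponential_on_circles[OF f, of K] by (auto simp: K_def)
  obtain m S where mS: "S \<ge> R" "sphere 0 S \<subseteq> (f ^^ m) ` ball p e"
  proof -
    have "\<exists>m S. S \<ge> R \<and> sphere 0 S \<subseteq> (f ^^ m) ` ball p e"
    proof (rule ccontr)
      assume neg: "\<not> ?thesis"
      have "\<exists>a. cmod a = R \<and> a \<notin> (f ^^ m) ` ball p e" for m
        using neg by (force simp: subset_iff)
      then obtain a where a: "\<And>m. cmod (a m) = R" "\<And>m. a m \<notin> (f ^^ m) ` ball p e" by metis
      have "\<not> sphere 0 (2 * R) \<subseteq> (f ^^ m) ` ball p e" for m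
        using neg R(1) by auto
      then have "\<exists>b. cmod b = 2 * R \<and> b \<notin> (f ^^ m) ` ball p e" for m
        by (force simp: subset_iff)
      then obtain b where b: "\<And>m. cmod (b m) = 2 * R" "\<And>m. b m \<notin> (f ^^ m) ` ball p e" by metis
      have "R \<le> cmod (a n - b n)" for n
        using norm_triangle_ineq2[of "b n" "a n"] a(1)[of n] b(1)[of n] by (simp add: norm_minus_commute)
      then show False
        using Julia_hits_moving_pair[OF hol p e, of R a b "2 * R" 0] a b R(1) by auto
    qed
    then show ?thesis using that by blast
  qed
  have "1 < real K / real A" using A by (simp add: K_def field_simps)
  then obtain N where N: "real A ^ Suc m < (real K / real A) ^ N" using real_arch_pow by blast
  obtain n where n: "n \<ge> m + N" "0 \<in> (f ^^ n) ` ball p e \<or> 1 \<in> (f ^^ n) ` ball p e"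
    using Julia_hits_one_of_two[OF hol p e, of 0 1 "m + N"] by auto
  then obtain z0 where z0: "z0 \<in> ball p e" "cmod ((f ^^ n) z0) \<le> 1" by force
  define k where "k = n - m"
  have k: "n = k + m" "k \<ge> N" using n by (auto simp: k_def)
  obtain w where w: "cmod w = S" "S ^ (K ^ k) \<le> cmod ((f ^^ k) w)" using R(2)[OF mS(1)] by blast
  then obtain z1 where z1: "z1 \<in> ball p e" "w = (f ^^ m) z1" using mS(2) by auto
  have S3: "S \<ge> 3" using mS R by simp
  have lnS: "ln S \<ge> 1"
    using S3 exp_le ln_ge_iff[of S 1] by linarith
  have "real A ^ Suc n = real A ^ Suc m * real A ^ k" by (simp add: k power_add)
  also have "\<dots> \<le> (real K / real A) ^ k * real A ^ k"
  proof (rule mult_right_mono)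
    show "real A ^ Suc m \<le> (real K / real A) ^ k"
      using N power_increasing[OF k(2), of "real K / real A"] \<open>1 < real K / real A\<close> by linarith
  qed auto
  also have "\<dots> = real K ^ k * 1" using A by (simp add: power_divide)
  also have "\<dots> \<le> real K ^ k * ln S" using lnS by (intro mult_left_mono) auto
  also have "\<dots> = ln (S ^ (K ^ k))" using S3 by (simp add: ln_realpow)
  also have "\<dots> \<le> ln (cmod ((f ^^ n) z1))"
  proof -
    have "0 < S ^ (K ^ k)" using S3 by simp
    then show ?thesis using w z1 k(1) by (simp add: funpow_add ln_mono)
  qed
  finally show ?thesis using that z0 z1 by blast
qed

text \<open>
  Rescaled iterates converge to a nonconstant entire function, and the scales $\rho_k$ tend to $0$ faster than
  $A^{-n_k}$ for every $A$.  This decay is what separates the transcendental case from the polynomial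
  one, where the exponents of periodic points are bounded.
\<close>

lemma superexponential_rescaling:
  assumes f: "transcendental_entire f" and p: "p \<in> Julia_set f"
  obtains r :: "nat \<Rightarrow> nat" and q :: "nat \<Rightarrow> complex" and \<rho> :: "nat \<Rightarrow> real"
    and n :: "nat \<Rightarrow> nat" and G where "strict_mono r"
    "\<And>k. dist p (q k) < 6 / real (Suc k)" "\<And>k. 0 < \<rho> k"
    "\<And>k. \<rho> k * real (Suc k) ^ Suc (n k) \<le> 8"
    "G holomorphic_on UNIV" "\<not> G constant_on UNIV"
    "\<And>K. compact K \<Longrightarrow> uniform_limit K (\<lambda>k (\<zeta>::complex). (f ^^ n (r k)) (q (r k) + \<rho> (r k) * \<zeta>)) G sequentially"
proof -
  have hol: "f holomorphic_on UNIV" using f by (simp add: transcendental_entire_def)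
  have "\<exists>n q \<rho>. dist p q < 6 / real (Suc k) \<and> 0 < \<rho> \<and> \<rho> * real (Suc k) ^ Suc n \<le> 8 \<and>
      cmod (deriv (f ^^ n) q) * \<rho> = 1 \<and>
      (\<forall>\<zeta>. cmod \<zeta> \<le> 3 * real (Suc k) / 16 \<longrightarrow> cmod ((f ^^ n) (q + \<rho> * \<zeta>)) \<le> exp (4 * cmod \<zeta>))" for k
  proof -
    define e where "e = 1 / real (Suc k)"
    have e: "0 < e" "e \<le> 1" by (auto simp: e_def)
    obtain n z0 z1 where z: "z0 \<in> ball p e" "z1 \<in> ball p e" "cmod ((f ^^ n) z0) \<le> 1"
      "real (Suc k) ^ Suc n \<le> ln (cmod ((f ^^ n) z1))"
      by (rule Julia_explosion[OF f p e(1), of "Suc k"]) simp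
    define L where "L = real (Suc k) ^ Suc n"
    have L: "L \<ge> real (Suc k)"
      using power_increasing[of 1 "Suc n" "real (Suc k)"] unfolding L_def by simp
    then have L0: "L > 0" by simp
    obtain q \<rho> where q: "dist p q < 6 * e" "0 < \<rho>" "\<rho> \<le> 8 * e / L" "cmod (deriv (f ^^ n) q) * \<rho> = 1"
      "\<And>\<zeta>. cmod \<zeta> \<le> 3 * L / 16 \<Longrightarrow> cmod ((f ^^ n) (q + \<rho> * \<zeta>)) \<le> exp (4 * cmod \<zeta>)"
      using rescaling_point[OF holomorphic_on_compow[OF hol] e(1) L0 z(1,3,2)] z(4) L_def by metis
    have "\<rho> * L \<le> 8 * e" using q(3) L0 by (simp add: field_simps)
    then have "\<rho> * L \<le> 8" using e by linarith
    moreover have "cmod ((f ^^ n) (q + \<rho> * \<zeta>)) \<le> exp (4 * cmod \<zeta>)"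
      if \<zeta>: "cmod \<zeta> \<le> 3 * real (Suc k) / 16" for \<zeta> :: complex
    proof (rule q(5))
      have "3 * real (Suc k) / 16 \<le> 3 * L / 16" using L by (intro divide_right_mono mult_left_mono) auto
      with \<zeta> show "cmod \<zeta> \<le> 3 * L / 16" by (rule order_trans)
    qed
    moreover have "dist p q < 6 / real (Suc k)" using q(1) by (simp add: e_def)
    ultimately show ?thesis
      using q(2,4) unfolding L_def by blast
  qed
  then obtain n q \<rho> where q: "\<And>k. dist p (q k) < 6 / real (Suc k)" "\<And>k. 0 < \<rho> k"
      "\<And>k. \<rho> k * real (Suc k) ^ Suc (n k) \<le> 8"
    and D: "\<And>k. cmod (deriv (f ^^ n k) (q k)) * \<rho> k = 1"
    and bd: "\<And>k \<zeta>. cmod \<zeta> \<le> 3 * real (Suc k) / 16 \<Longrightarrow>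
       cmod ((f ^^ n k) (q k + \<rho> k * \<zeta>)) \<le> exp (4 * cmod \<zeta>)"
    by metis
  define g where "g = (\<lambda>k (\<zeta>::complex). (f ^^ n k) (q k + \<rho> k * \<zeta>))"
  have holg: "g k holomorphic_on A" for k A
  proof -
    have "((f ^^ n k) \<circ> (\<lambda>\<zeta>. q k + \<rho> k * \<zeta>)) holomorphic_on A"
      by (intro holomorphic_on_compose_gen[OF _ holomorphic_on_compow[OF hol, where A=UNIV]] holomorphic_intros) auto
    then show ?thesis by (simp add: g_def o_def)
  qed
  have dg: "(g k has_field_derivative deriv (f ^^ n k) (q k + \<rho> k * \<zeta>) * \<rho> k) (at \<zeta>)" for k and \<zeta> :: complex
    unfolding g_def
    by (rule DERIV_chain2[OF iterate_has_field_derivative[OF hol]]) (auto intro!: derivative_eq_intros)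
  obtain G r where G: "G holomorphic_on UNIV" "strict_mono (r :: nat \<Rightarrow> nat)"
    "\<And>K. \<lbrakk>compact K; K \<subseteq> UNIV\<rbrakk> \<Longrightarrow> uniform_limit K (g \<circ> r) G sequentially"
  proof (rule Montel[of UNIV "range g" g])
    show "\<exists>B. \<forall>h\<in>range g. \<forall>z\<in>K. cmod (h z) \<le> B" if K: "compact K" "K \<subseteq> UNIV" for K
    proof -
      obtain R where R: "\<And>z. z \<in> K \<Longrightarrow> cmod z \<le> R"
        using compact_imp_bounded[OF K(1)] by (auto simp: bounded_iff)
      obtain k0 :: nat where k0: "16 * R / 3 < real k0" using reals_Archimedean2 by blast
      have "\<exists>B. \<forall>z\<in>K. cmod (g k z) \<le> B" for k
      proof -
        have "compact (g k ` K)"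
          using K by (intro compact_continuous_image holomorphic_on_imp_continuous_on holg)
        then show ?thesis by (meson bounded_iff compact_imp_bounded imageI)
      qed
      then obtain B where B: "\<And>k z. z \<in> K \<Longrightarrow> cmod (g k z) \<le> B k" by metis
      define B' where "B' = Max (insert (exp (4 * R)) (B ` {..<k0}))"
      have "cmod (g k z) \<le> B'" if z: "z \<in> K" for k z
      proof (cases "k < k0")
        case True
        have "cmod (g k z) \<le> B k" using B z by blast
        also have "\<dots> \<le> B'" unfolding B'_def using True by (intro Max_ge) auto
        finally show ?thesis .
      next
        case False
        have "cmod z \<le> 3 * real (Suc k) / 16" using R[OF z] k0 False by simp
        then have "cmod (g k z) \<le> exp (4 * cmod z)" unfolding g_def by (rule bd)
        also have "\<dots> \<le> exp (4 * R)" using R[OF z] by simp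
        also have "\<dots> \<le> B'" unfolding B'_def by (intro Max_ge) auto
        finally show ?thesis .
      qed
      then show ?thesis by blast
    qed
  qed (use holg in auto)
  have "\<not> G constant_on UNIV"
  proof
    assume "G constant_on UNIV"
    then obtain c where c: "G = (\<lambda>_. c)" by (auto simp: constant_on_def)
    obtain G' where G': "\<forall>x::complex\<in>UNIV. (G has_field_derivative G' x) (at x) \<and>
        (\<lambda>k. deriv (f ^^ n (r k)) (q (r k) + \<rho> (r k) * x) * \<rho> (r k)) \<longlonglongrightarrow> G' x"
    proof (rule exE[OF has_complex_derivative_uniform_sequence[of UNIV "g \<circ> r"]])
      show "\<exists>d>0. cball x d \<subseteq> UNIV \<and> uniform_limit (cball x d) (g \<circ> r) G sequentially" for x
        using G(3)[of "cball x 1"] by (intro exI[of _ 1]) auto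
    qed (use dg in auto)
    have "(\<lambda>k. cmod (deriv (f ^^ n (r k)) (q (r k) + \<rho> (r k) * 0) * \<rho> (r k))) \<longlonglongrightarrow> cmod (G' 0)"
      using bspec[OF G', of 0] by (intro tendsto_norm) simp
    moreover have "cmod (deriv (f ^^ n (r k)) (q (r k) + \<rho> (r k) * 0) * \<rho> (r k)) = 1" for k
      using D[of "r k"] q(2)[of "r k"] by (simp add: norm_mult)
    ultimately have "cmod (G' 0) = 1" by (simp add: LIMSEQ_const_iff)
    moreover have "G' 0 = 0" using G' c DERIV_unique[of G "G' 0" 0 0] by auto
    ultimately show False by simp
  qed
  then show ?thesis
    using that[OF G(2) q G(1)] G(3) by (simp add: g_def o_def)
qed


text \<open>
  The points to be avoided are the critical values of all iterates and the Picard exceptional value.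
  They form a countable set, while the Julia set is uncountable near each of its points.
\<close>

lemma generic_Julia_point:
  assumes f: "transcendental_entire f" and p: "p \<in> Julia_set f" and e: "e > 0"
  obtains p' y where "p' \<in> Julia_set f" "dist p p' < e" "y \<noteq> p'" "f y = p'"
    "\<And>T u. (f ^^ T) u = p' \<Longrightarrow> deriv (f ^^ T) u \<noteq> 0"
proof -
  have hol: "f holomorphic_on UNIV" using f by (simp add: transcendental_entire_def)
  obtain a where a: "\<And>w. w \<noteq> a \<Longrightarrow> infinite {z. f z = w}"
    using transcendental_entire_infinite_preimages[OF f] by blast
  define bad where "bad = insert a (\<Union>T. (f ^^ T) ` {z. deriv (f ^^ T) z = 0})"
  have "countable bad"
    unfolding bad_def
    by (intro countable_insert countable_UN countable_critical_values holomorphic_on_compow[OF hol]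
        iterate_nonconstant[OF f]) auto
  then have "\<not> Julia_set f \<inter> ball p e \<subseteq> bad"
    using uncountable_Julia_set_ball[OF f p e] countable_subset by blast
  then obtain p' where p': "p' \<in> Julia_set f" "p' \<in> ball p e" "p' \<notin> bad" by blast
  have "infinite {z. f z = p'}" using a p'(3) by (auto simp: bad_def)
  then have "\<not> {z. f z = p'} \<subseteq> {p'}" using finite_subset by blast
  then obtain y where "f y = p'" "y \<noteq> p'" by blast
  moreover have "deriv (f ^^ T) u \<noteq> 0" if "(f ^^ T) u = p'" for T u
    using p'(3) that unfolding bad_def by blast
  ultimately show ?thesis using that p' by auto
qed

text \<open>
  The values of $G$ at its noncritical points include points of the Julia set, because $G$ omits at
  most one value and has countably many critical values.  A neighbourhood of such a value is spread by
  the iterates over $p$ or over a given preimage of $p$, hence over $p$.  That $p$ is no critical value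
  of any iterate makes the return simple.
\<close>

lemma simple_return_to_generic_point:
  assumes f: "transcendental_entire f" and p: "p \<in> Julia_set f"
    and y: "y \<noteq> p" "f y = p"
    and simple: "\<And>T u. (f ^^ T) u = p \<Longrightarrow> deriv (f ^^ T) u \<noteq> 0"
    and G: "G holomorphic_on UNIV" "\<not> G constant_on UNIV"
  obtains T \<zeta> where "(f ^^ T) (G \<zeta>) = p" "deriv (f ^^ T) (G \<zeta>) * deriv G \<zeta> \<noteq> 0"
proof -
  have hol: "f holomorphic_on UNIV" using f by (simp add: transcendental_entire_def)
  let ?bad = "G ` {z. deriv G z = 0}"
  have "uncountable (Julia_set f \<inter> ball p 1)" by (rule uncountable_Julia_set_ball[OF f p]) simp
  then have unc: "uncountable (Julia_set f - ?bad)"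
    using countable_critical_values[OF G] countable_subset[of "Julia_set f \<inter> ball p 1" "Julia_set f"]
    by (metis Int_lower1 uncountable_minus_countable)
  then have "Julia_set f - ?bad \<noteq> {}" by (metis countable_empty)
  then obtain a where a: "a \<in> Julia_set f - ?bad" by blast
  have "uncountable (Julia_set f - ?bad - {a})" using unc by (rule uncountable_minus_countable) simp
  then have "Julia_set f - ?bad - {a} \<noteq> {}" by (metis countable_empty)
  then obtain b where b: "b \<in> Julia_set f - ?bad - {a}" by blast
  have "range G \<inter> {a, b} \<noteq> {}"
  proof
    assume "range G \<inter> {a, b} = {}"
    moreover have "a \<noteq> b" using b by blast
    ultimately obtain c where "G = (\<lambda>x. c)" using little_Picard[OF G(1)] by metis
    with G(2) show False by (auto simp: constant_on_def)
  qed
  then obtain \<zeta>1 where \<zeta>1: "G \<zeta>1 \<in> Julia_set f" "G \<zeta>1 \<notin> ?bad" using a b by auto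
  define V where "V = {z. deriv G z \<noteq> 0}"
  have "continuous_on UNIV (deriv G)"
    using G(1) by (intro holomorphic_on_imp_continuous_on holomorphic_deriv) auto
  then have "open V" unfolding V_def by (intro open_Collect_neq) auto
  then have "open (G ` V)" using open_mapping_thm[OF G(1) open_UNIV connected_UNIV _ _ G(2)] by simp
  moreover have "G \<zeta>1 \<in> G ` V" using \<zeta>1 by (auto simp: V_def)
  ultimately obtain s where s: "s > 0" "ball (G \<zeta>1) s \<subseteq> G ` V" using open_contains_ball by blast
  obtain n where "y \<in> (f ^^ n) ` ball (G \<zeta>1) s \<or> p \<in> (f ^^ n) ` ball (G \<zeta>1) s"
    using Julia_hits_one_of_two[OF hol \<zeta>1(1) s(1) y(1)] by blast
  then have "\<exists>T u. u \<in> ball (G \<zeta>1) s \<and> (f ^^ T) u = p"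
  proof
    assume "y \<in> (f ^^ n) ` ball (G \<zeta>1) s"
    then obtain u where "u \<in> ball (G \<zeta>1) s" "(f ^^ Suc n) u = p" using y by auto
    then show ?thesis by blast
  qed blast
  then obtain T u where u: "u \<in> ball (G \<zeta>1) s" "(f ^^ T) u = p" by blast
  then obtain \<zeta> where "\<zeta> \<in> V" "u = G \<zeta>" using s(2) by blast
  then show ?thesis using that[of T \<zeta>] simple u by (auto simp: V_def)
qed

text \<open>
  Near $q_k$ the iterate $f^{n_k}$ looks like $G$ on the scale $\rho_k$, and some $f^T$ brings the
  values of $G$ back to $p$.  The equation $f^{T+n_k}(x) = x$ for $x = q_k + \rho_k\zeta$ tends to
  $f^T(G(\zeta)) = p$, which has a simple solution, so Hurwitz's theorem provides periodic points.
  Their multipliers are comparable to $1/\rho_k$, far larger than $M^{T+n_k}$.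
\<close>

lemma periodic_point_of_large_multiplier_near_generic:
  assumes f: "transcendental_entire f" and p: "p \<in> Julia_set f" and e: "e > 0" and M: "M \<ge> 1"
    and y: "y \<noteq> p" "f y = p"
    and simple: "\<And>T u. (f ^^ T) u = p \<Longrightarrow> deriv (f ^^ T) u \<noteq> 0"
  obtains x N where "dist p x < e" "(f ^^ N) x = x" "M ^ N < cmod (deriv (f ^^ N) x)"
proof -
  have hol: "f holomorphic_on UNIV" using f by (simp add: transcendental_entire_def)
  obtain r q \<rho> n G where r: "strict_mono (r :: nat \<Rightarrow> nat)"
    and q: "\<And>k. dist p (q k) < 6 / real (Suc k)"
    and \<rho>: "\<And>k. 0 < \<rho> k" "\<And>k. \<rho> k * real (Suc k) ^ Suc (n k) \<le> 8"
    and G: "G holomorphic_on UNIV" "\<not> G constant_on UNIV"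
    and ul: "\<And>K. compact K \<Longrightarrow> uniform_limit K (\<lambda>k (\<zeta>::complex). (f ^^ n (r k)) (q (r k) + \<rho> (r k) * \<zeta>)) G sequentially"
  proof (rule superexponential_rescaling[OF f p])
    fix r :: "nat \<Rightarrow> nat" and q :: "nat \<Rightarrow> complex" and \<rho> :: "nat \<Rightarrow> real" and n :: "nat \<Rightarrow> nat" and G
    assume "strict_mono r" "\<And>k. dist p (q k) < 6 / real (Suc k)" "\<And>k. 0 < \<rho> k"
      "\<And>k. \<rho> k * real (Suc k) ^ Suc (n k) \<le> 8" "G holomorphic_on UNIV" "\<not> G constant_on UNIV"
      "\<And>K. compact K \<Longrightarrow> uniform_limit K (\<lambda>k (\<zeta>::complex). (f ^^ n (r k)) (q (r k) + \<rho> (r k) * \<zeta>)) G sequentially"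
    then show thesis by (rule that)
  qed
  obtain T \<zeta>0 where T: "(f ^^ T) (G \<zeta>0) = p" "deriv (f ^^ T) (G \<zeta>0) * deriv G \<zeta>0 \<noteq> 0"
    using simple_return_to_generic_point[OF f p y simple G] by blast
  define g where "g = (\<lambda>k (\<zeta>::complex). (f ^^ n (r k)) (q (r k) + \<rho> (r k) * \<zeta>))"
  define H where "H = (\<lambda>\<zeta>. (f ^^ T) (G \<zeta>) - p)"
  define h where "h = (\<lambda>k (\<zeta>::complex). (f ^^ T) (g k \<zeta>) - (q (r k) + \<rho> (r k) * \<zeta>))"
  have "((f ^^ T) \<circ> G) holomorphic_on UNIV"
    by (intro holomorphic_on_compose_gen[OF G(1) holomorphic_on_compow[OF hol, where A=UNIV]]) auto
  then have holH: "H holomorphic_on UNIV" unfolding H_def o_def by (intro holomorphic_intros)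
  have dg: "(g k has_field_derivative deriv (f ^^ n (r k)) (q (r k) + \<rho> (r k) * \<zeta>) * \<rho> (r k)) (at \<zeta>)" for k and \<zeta> :: complex
    unfolding g_def
    by (rule DERIV_chain2[OF iterate_has_field_derivative[OF hol]]) (auto intro!: derivative_eq_intros)
  have dh: "(h k has_field_derivative
      (deriv (f ^^ (T + n (r k))) (q (r k) + \<rho> (r k) * \<zeta>) - 1) * \<rho> (r k)) (at \<zeta>)" for k and \<zeta> :: complex
  proof -
    have "(h k has_field_derivative
      deriv (f ^^ T) (g k \<zeta>) * (deriv (f ^^ n (r k)) (q (r k) + \<rho> (r k) * \<zeta>) * \<rho> (r k)) - \<rho> (r k)) (at \<zeta>)"
      unfolding h_def
      by (intro DERIV_diff DERIV_chain2[OF iterate_has_field_derivative[OF hol] dg])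
        (auto intro!: derivative_eq_intros)
    then show ?thesis by (simp add: deriv_iterate_add[OF hol] g_def algebra_simps)
  qed
  then have holh: "h k holomorphic_on UNIV" for k
    unfolding holomorphic_on_open[OF open_UNIV] by blast
  have dH0: "deriv H \<zeta>0 \<noteq> 0"
  proof -
    have "(H has_field_derivative deriv (f ^^ T) (G \<zeta>0) * deriv G \<zeta>0 - 0) (at \<zeta>0)"
      unfolding H_def
      by (intro DERIV_diff DERIV_chain2[OF iterate_has_field_derivative[OF hol]] DERIV_const
          entire_has_field_derivative G)
    then show ?thesis using T(2) by (simp add: DERIV_imp_deriv)
  qed
  have shift: "uniform_limit K (\<lambda>k (\<zeta>::complex). q (r k) + \<rho> (r k) * \<zeta>) (\<lambda>\<zeta>. p) sequentially" if K: "compact K" for K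
  proof -
    obtain R where R: "R > 0" "\<And>\<zeta>. \<zeta> \<in> K \<Longrightarrow> cmod \<zeta> \<le> R"
      using compact_imp_bounded[OF K] unfolding bounded_pos by blast
    have lim: "(\<lambda>k. (6 + 8 * R) / real (Suc k)) \<longlonglongrightarrow> 0"
      by (rule LIMSEQ_Suc) (rule lim_const_over_n)
    have small: "dist (q (r k) + \<rho> (r k) * \<zeta>) p \<le> (6 + 8 * R) / real (Suc k)" if \<zeta>: "\<zeta> \<in> K" for k and \<zeta> :: complex
    proof -
      have "dist (q (r k) + \<rho> (r k) * \<zeta>) p \<le> dist p (q (r k)) + \<rho> (r k) * cmod \<zeta>"
        using norm_triangle_ineq[of "q (r k) - p" "\<rho> (r k) * \<zeta>"] \<rho>(1)[of "r k"]
        by (simp add: dist_norm norm_mult norm_minus_commute algebra_simps)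
      also have "\<dots> \<le> 6 / real (Suc (r k)) + 8 / real (Suc (r k)) * R"
      proof (intro add_mono mult_mono)
        have "\<rho> (r k) * real (Suc (r k)) ^ 1 \<le> \<rho> (r k) * real (Suc (r k)) ^ Suc (n (r k))"
          using \<rho>(1)[of "r k"] by (intro mult_left_mono power_increasing) auto
        then have "\<rho> (r k) * real (Suc (r k)) \<le> 8" 
          using \<rho>(2)[of "r k"] unfolding power_one_right by (rule order_trans)
        then show "\<rho> (r k) \<le> 8 / real (Suc (r k))" by (simp add: field_simps)
      qed (use R q[of "r k"] \<zeta> in auto)
      also have "\<dots> = (6 + 8 * R) / real (Suc (r k))" by (simp add: add_divide_distrib)
      also have "\<dots> \<le> (6 + 8 * R) / real (Suc k)"
        using R(1) seq_suble[OF r, of k] by (intro divide_left_mono) auto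
      finally show ?thesis .
    qed
    show ?thesis
      unfolding uniform_limit_iff
    proof (intro allI impI)
      fix \<epsilon> :: real assume "\<epsilon> > 0"
      then have "\<forall>\<^sub>F k in sequentially. (6 + 8 * R) / real (Suc k) < \<epsilon>"
        using order_tendstoD(2)[OF lim] by blast
      then show "\<forall>\<^sub>F k in sequentially. \<forall>\<zeta>\<in>K. dist (q (r k) + \<rho> (r k) * \<zeta>) p < \<epsilon>"
        by eventually_elim (use small in \<open>blast intro: le_less_trans\<close>)
    qed
  qed
  have ulh: "uniform_limit K h H sequentially" if K: "compact K" for K
  proof -
    have ulg: "uniform_limit K g G sequentially" using ul[OF K] by (simp add: g_def)
    have "bounded (G ` K)"
      using G(1) K by (intro compact_imp_bounded compact_continuous_image)
        (auto intro: holomorphic_on_imp_continuous_on holomorphic_on_subset)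
    then obtain B where B: "\<And>\<zeta>. \<zeta> \<in> K \<Longrightarrow> cmod (G \<zeta>) \<le> B" by (auto simp: bounded_iff)
    have ev: "\<forall>\<^sub>F k in sequentially. \<forall>\<zeta>\<in>K. g k \<zeta> \<in> cball 0 (B + 1)"
    proof -
      have "\<forall>\<^sub>F k in sequentially. \<forall>\<zeta>\<in>K. dist (g k \<zeta>) (G \<zeta>) < 1"
        using ulg by (simp add: uniform_limit_iff)
      then show ?thesis
      proof eventually_elim
        case (elim k)
        show ?case
        proof
          fix \<zeta> assume \<zeta>: "\<zeta> \<in> K"
          then show "g k \<zeta> \<in> cball 0 (B + 1)"
            using bspec[OF elim \<zeta>] B[OF \<zeta>] norm_triangle_ineq2[of "g k \<zeta>" "G \<zeta>"] by (simp add: dist_norm)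
        qed
      qed
    qed
    have "uniformly_continuous_on (cball 0 (B + 1)) (f ^^ T)"
      by (intro compact_uniformly_continuous holomorphic_on_imp_continuous_on holomorphic_on_compow[OF hol]) auto
    then have 1: "uniform_limit K (\<lambda>k (\<zeta>::complex). (f ^^ T) (g k \<zeta>)) (\<lambda>\<zeta>. (f ^^ T) (G \<zeta>)) sequentially"
      by (rule uniform_limit_compose_uniformly_continuous_on[OF ulg _ ev]) auto
    show ?thesis unfolding h_def H_def by (intro uniform_limit_minus 1 shift K)
  qed
  define c where "c = cmod (deriv H \<zeta>0) / 2"
  have c: "c > 0" using dH0 by (simp add: c_def)
  have "continuous_on UNIV (\<lambda>z. cmod (deriv H z))"
    by (intro continuous_intros holomorphic_on_imp_continuous_on holomorphic_deriv holH) auto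
  then have "open {z. c < cmod (deriv H z)}" by (intro open_Collect_less) auto
  moreover have "\<zeta>0 \<in> {z. c < cmod (deriv H z)}" using c by (simp add: c_def)
  ultimately obtain s where s: "s > 0" "ball \<zeta>0 s \<subseteq> {z. c < cmod (deriv H z)}"
    using open_contains_ball by blast
  have "\<forall>\<^sub>F k in sequentially. \<forall>u\<in>cball \<zeta>0 (2 * s). dist (h k u) (H u) < c / 2 * s"
    by (rule uniform_limitD[OF ulh[OF compact_cball]]) (use c s(1) in simp)
  moreover have "\<forall>\<^sub>F k in sequentially. \<forall>u\<in>cball \<zeta>0 s. dist (q (r k) + \<rho> (r k) * u) p < e"
    using shift[OF compact_cball] e unfolding uniform_limit_iff by blast
  moreover have "\<forall>\<^sub>F k in sequentially. 16 * (M ^ T + 1) / c \<le> real k"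
    using filterlim_real_sequentially by (simp add: filterlim_at_top)
  moreover have "\<forall>\<^sub>F k in sequentially. M \<le> real k"
    using filterlim_real_sequentially by (simp add: filterlim_at_top)
  ultimately have "\<forall>\<^sub>F k in sequentially.
      (\<forall>u\<in>cball \<zeta>0 (2 * s). dist (h k u) (H u) < c / 2 * s) \<and>
      (\<forall>u\<in>cball \<zeta>0 s. dist (q (r k) + \<rho> (r k) * u) p < e) \<and>
      16 * (M ^ T + 1) / c \<le> real k \<and> M \<le> real k"
    by eventually_elim blast
  then obtain k0 where k0: "\<And>k. k \<ge> k0 \<Longrightarrow>
      (\<forall>u\<in>cball \<zeta>0 (2 * s). dist (h k u) (H u) < c / 2 * s) \<and>
      (\<forall>u\<in>cball \<zeta>0 s. dist (q (r k) + \<rho> (r k) * u) p < e) \<and>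
      16 * (M ^ T + 1) / c \<le> real k \<and> M \<le> real k"
    unfolding eventually_sequentially by blast
  \<comment> \<open>Hurwitz's theorem: the limit \<open>H\<close> vanishes at \<open>\<zeta>0\<close>, so the functions \<open>h k\<close> cannot all be free of zeros nearby.\<close>
  have "\<exists>k\<ge>k0. \<exists>\<zeta>\<in>ball \<zeta>0 s. h k \<zeta> = 0"
  proof (rule ccontr)
    assume neg: "\<not> ?thesis"
    have "H \<zeta>0 \<noteq> 0"
    proof (rule Hurwitz_no_zeros[of "ball \<zeta>0 s" "\<lambda>k. h (k + k0)" H \<zeta>0])
      show "h (k + k0) holomorphic_on ball \<zeta>0 s" for k
        using holh holomorphic_on_subset by blast
      show "H holomorphic_on ball \<zeta>0 s" using holH holomorphic_on_subset by blast
      show "uniform_limit K (\<lambda>k. h (k + k0)) H sequentially" if "compact K" "K \<subseteq> ball \<zeta>0 s" for K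
        by (rule filterlim_compose[OF ulh[OF that(1)] filterlim_add_const_nat_at_top])
      show "\<not> H constant_on ball \<zeta>0 s"
      proof
        assume "H constant_on ball \<zeta>0 s"
        then obtain d where d: "\<And>u. u \<in> ball \<zeta>0 s \<Longrightarrow> H u = d" by (auto simp: constant_on_def)
        have "(H has_field_derivative 0) (at \<zeta>0)"
        proof (rule has_field_derivative_transform_within_open[of "\<lambda>_. d" 0 \<zeta>0 "ball \<zeta>0 s"])
        qed (use d s in auto)
        then show False using dH0 DERIV_imp_deriv by blast
      qed
      show "h (k + k0) z \<noteq> 0" if "z \<in> ball \<zeta>0 s" for k z
        using neg that le_add2 by blast
    qed (use s in auto)
    then show False using T(1) by (simp add: H_def)
  qed
  then obtain k \<zeta> where k: "k \<ge> k0" and \<zeta>: "\<zeta> \<in> ball \<zeta>0 s" "h k \<zeta> = 0" by blast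
  define x where "x = q (r k) + \<rho> (r k) * \<zeta>"
  define N where "N = T + n (r k)"
  have fx: "(f ^^ N) x = x" using \<zeta>(2) by (simp add: h_def g_def x_def N_def funpow_add)
  have "cmod (deriv (h k) \<zeta> - deriv H \<zeta>) \<le> c / 2 * s / s"
  proof (rule deriv_difference_le[OF holh holH s(1)])
    fix u assume "u \<in> cball \<zeta> s"
    then have "u \<in> cball \<zeta>0 (2 * s)" using \<zeta>(1) dist_triangle[of \<zeta>0 u \<zeta>] by auto
    then have "dist (h k u) (H u) < c / 2 * s" using k0[OF k] by blast
    then show "cmod (h k u - H u) \<le> c / 2 * s" by (simp add: dist_norm)
  qed
  moreover have "c < cmod (deriv H \<zeta>)" using s(2) \<zeta>(1) by auto
  ultimately have "c / 2 \<le> cmod (deriv (h k) \<zeta>)"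
    using s(1) norm_triangle_ineq2[of "deriv H \<zeta>" "deriv (h k) \<zeta>"] by (simp add: norm_minus_commute)
  also have "deriv (h k) \<zeta> = (deriv (f ^^ N) x - 1) * \<rho> (r k)"
    using DERIV_imp_deriv[OF dh] by (simp add: x_def N_def)
  also have "cmod \<dots> \<le> (cmod (deriv (f ^^ N) x) + 1) * \<rho> (r k)"
    using \<rho>(1)[of "r k"] norm_triangle_ineq4[of "deriv (f ^^ N) x" 1]
    by (simp add: norm_mult)
  \<comment> \<open>The multiplier is at least of the order of the reciprocal of the scale.\<close>
  finally have A: "c / 2 \<le> (cmod (deriv (f ^^ N) x) + 1) * \<rho> (r k)" .
  define D where "D = cmod (deriv (f ^^ N) x) + 1"
  let ?K = "real (Suc (r k))"
  have D: "D > 0" by (simp add: D_def add_nonneg_pos)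
  have "c / 2 * ?K ^ Suc (n (r k)) \<le> D * \<rho> (r k) * ?K ^ Suc (n (r k))"
    using A unfolding D_def by (intro mult_right_mono) auto
  also have "\<dots> = D * (\<rho> (r k) * ?K ^ Suc (n (r k)))" by (simp only: mult.assoc)
  also have "\<dots> \<le> D * 8" using D \<rho>(2) by (intro mult_left_mono) auto
  finally have B: "c * ?K / 16 * ?K ^ n (r k) \<le> D" by (simp add: field_simps)
  have Kk: "real k < ?K" using seq_suble[OF r, of k] by simp
  have "M ^ N + 1 \<le> (M ^ T + 1) * M ^ n (r k)"
    using M by (simp add: N_def power_add algebra_simps)
  also have "\<dots> < (c * ?K / 16) * M ^ n (r k)"
  proof (rule mult_strict_right_mono)
    have "16 * (M ^ T + 1) / c < ?K" using k0[OF k] Kk by linarith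
    then show "M ^ T + 1 < c * ?K / 16" using c by (simp add: field_simps)
  qed (use M in auto)
  also have "\<dots> \<le> (c * ?K / 16) * ?K ^ n (r k)"
    using k0[OF k] Kk M c by (intro mult_left_mono power_mono) auto
  also have "\<dots> \<le> D" by (rule B)
  finally have "M ^ N < cmod (deriv (f ^^ N) x)" by (simp add: D_def)
  moreover have "dist p x < e"
    using k0[OF k] \<zeta>(1) unfolding x_def by (metis ball_subset_cball dist_commute subsetD)
  ultimately show ?thesis using that fx by blast
qed

lemma periodic_points_of_large_multiplier_dense:
  assumes f: "transcendental_entire f" and p: "p \<in> Julia_set f" and e: "e > 0" and M: "M \<ge> 1"
  obtains x N where "dist p x < e" "(f ^^ N) x = x" "M ^ N < cmod (deriv (f ^^ N) x)"
proof -
  have e2: "e / 2 > 0" using e by simp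
  obtain p' y where p': "p' \<in> Julia_set f" "dist p p' < e / 2" "y \<noteq> p'" "f y = p'"
    "\<And>T u. (f ^^ T) u = p' \<Longrightarrow> deriv (f ^^ T) u \<noteq> 0"
    using generic_Julia_point[OF f p e2] by blast
  obtain x N where x: "dist p' x < e / 2" "(f ^^ N) x = x" "M ^ N < cmod (deriv (f ^^ N) x)"
    using periodic_point_of_large_multiplier_near_generic[OF f p'(1) e2 M p'(3-5)] by blast
  have "dist p x < e" using dist_triangle[of p x p'] x(1) p'(2) by linarith
  then show ?thesis using that x by blast
qed


section \<open>Spherical derivatives along orbits\<close>

lemma spherical_deriv_iterate_add:
  assumes "f holomorphic_on UNIV"
  shows "spherical_deriv (f ^^ (m + n)) z =
    spherical_deriv (f ^^ m) ((f ^^ n) z) * cmod (deriv (f ^^ n) z)"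
  unfolding spherical_deriv_def deriv_iterate_add[OF assms] by (simp add: norm_mult funpow_add)

lemma spherical_deriv_pos_iff: "0 < spherical_deriv g z \<longleftrightarrow> deriv g z \<noteq> 0"
proof -
  have "0 < 1 + (cmod (g z))\<^sup>2" by (simp add: add_pos_nonneg)
  then show ?thesis by (simp add: spherical_deriv_def zero_less_divide_iff)
qed

lemma isCont_spherical_deriv:
  assumes "g holomorphic_on UNIV"
  shows "isCont (spherical_deriv g) z"
proof -
  have "continuous_on UNIV g" "continuous_on UNIV (deriv g)"
    using assms by (auto intro: holomorphic_on_imp_continuous_on holomorphic_deriv)
  moreover have "1 + (cmod (g z))\<^sup>2 \<noteq> 0" for z by (metis add_nonneg_eq_0_iff zero_le_one zero_le_power2 zero_neq_one)
  ultimately have "continuous_on UNIV (\<lambda>z. spherical_deriv g z)"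
    unfolding spherical_deriv_def by (intro continuous_intros) auto
  then show ?thesis by (simp add: continuous_on_eq_continuous_at)
qed

text \<open>
  The easy direction of Marty's theorem.  If a sequence of iterates tends to infinity, the spherical
  derivative is bounded by the derivative of the reciprocal, to which Cauchy's inequality applies.
\<close>

lemma spherical_deriv_iterates_bounded_on_Fatou:
  assumes hol: "f holomorphic_on UNIV" and z: "z \<notin> Julia_set f"
  shows "\<exists>B. \<forall>n. spherical_deriv (f ^^ n) z \<le> B"
proof (rule ccontr)
  assume "\<not> ?thesis"
  then have "\<exists>n. real i < spherical_deriv (f ^^ n) z" for i by (meson not_le)
  then obtain m where m: "\<And>i. real i < spherical_deriv (f ^^ m i) z" by metis
  obtain U where U: "open U" "z \<in> U" "normal_family_on U (range (\<lambda>n. f ^^ n))"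
    using z unfolding Julia_set_def by blast
  define F where "F = (\<lambda>i. f ^^ m i)"
  have "range F \<subseteq> range (\<lambda>n. f ^^ n)" by (auto simp: F_def)
  then obtain r :: "nat \<Rightarrow> nat" where r: "strict_mono r"
    "(\<exists>g. g holomorphic_on U \<and> locally_uniform_limit U (F \<circ> r) g) \<or>
        locally_uniform_limit_infinity U (F \<circ> r)"
    using U(3) unfolding normal_family_on_def by blast
  have large: "real i < spherical_deriv ((F \<circ> r) i) z" for i
    using m[of "r i"] seq_suble[OF r(1), of i] by (simp add: F_def)
  have "\<exists>B. \<forall>\<^sub>F i in sequentially. spherical_deriv ((F \<circ> r) i) z \<le> B"
    using r(2)
  proof
    assume "\<exists>g. g holomorphic_on U \<and> locally_uniform_limit U (F \<circ> r) g"
    then obtain g where g: "\<And>K. compact K \<Longrightarrow> K \<subseteq> U \<Longrightarrow> uniform_limit K (F \<circ> r) g sequentially"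
      unfolding locally_uniform_limit_def by blast
    have "\<exists>g'. \<forall>x\<in>U. (g has_field_derivative g' x) (at x) \<and> (\<lambda>i. deriv ((F \<circ> r) i) x) \<longlonglongrightarrow> g' x"
    proof (rule has_complex_derivative_uniform_sequence[OF U(1)])
      show "((F \<circ> r) n has_field_derivative deriv ((F \<circ> r) n) x) (at x)" for n x
        by (simp add: F_def iterate_has_field_derivative[OF hol])
      show "\<exists>d>0. cball x d \<subseteq> U \<and> uniform_limit (cball x d) (F \<circ> r) g sequentially" if x: "x \<in> U" for x
      proof -
        obtain d where "d > 0" "cball x d \<subseteq> U" using open_contains_cball_eq[OF U(1)] x by blast
        then show ?thesis using g[OF compact_cball] by blast
      qed
    qed
    then obtain l where "(\<lambda>i. deriv ((F \<circ> r) i) z) \<longlonglongrightarrow> l" using U(2) by blast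
    then have "\<forall>\<^sub>F i in sequentially. dist (deriv ((F \<circ> r) i) z) l < 1" by (rule tendstoD) simp
    then have "\<forall>\<^sub>F i in sequentially. spherical_deriv ((F \<circ> r) i) z \<le> cmod l + 1"
    proof eventually_elim
      case (elim i)
      have "spherical_deriv ((F \<circ> r) i) z \<le> cmod (deriv ((F \<circ> r) i) z) / 1"
        unfolding spherical_deriv_def by (intro divide_left_mono) (auto simp: add_pos_nonneg)
      also have "\<dots> \<le> cmod l + 1"
        using elim norm_triangle_ineq2[of "deriv ((F \<circ> r) i) z" l] by (simp add: dist_norm)
      finally show ?case .
    qed
    then show ?thesis by blast
  next
    assume inf: "locally_uniform_limit_infinity U (F \<circ> r)"
    obtain d where d: "d > 0" "cball z d \<subseteq> U" using open_contains_cball_eq[OF U(1)] U(2) by blast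
    then have "\<forall>\<^sub>F i in sequentially. \<forall>w\<in>cball z d. 1 < cmod ((F \<circ> r) i w)"
      using inf unfolding locally_uniform_limit_infinity_def by (meson compact_cball)
    then have "\<forall>\<^sub>F i in sequentially. spherical_deriv ((F \<circ> r) i) z \<le> 1 / d"
    proof eventually_elim
      case (elim i)
      let ?g = "(F \<circ> r) i"
      have holg: "?g holomorphic_on A" for A by (simp add: F_def holomorphic_on_compow[OF hol])
      have nz: "?g w \<noteq> 0" if "w \<in> cball z d" for w using elim that by fastforce
      have "cmod ((deriv ^^ 1) (\<lambda>w. inverse (?g w)) z) \<le> fact 1 * 1 / d ^ 1"
      proof (rule Cauchy_inequality[OF _ _ d(1)])
        show "(\<lambda>w. inverse (?g w)) holomorphic_on ball z d"
          using nz by (intro holomorphic_intros holg) auto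
        show "continuous_on (cball z d) (\<lambda>w. inverse (?g w))"
          using nz by (intro continuous_intros holomorphic_on_imp_continuous_on holg) auto
        show "cmod (inverse (?g w)) \<le> 1" if "cmod (z - w) = d" for w
        proof -
          have "w \<in> cball z d" using that by (simp add: dist_norm)
          then have "1 < cmod (?g w)" using elim by blast
          then show ?thesis by (simp add: norm_inverse inverse_le_1_iff)
        qed
      qed
      moreover have "deriv (\<lambda>w. inverse (?g w)) z = - (deriv ?g z / (?g z)\<^sup>2)"
      proof -
        have z: "?g z \<noteq> 0" using nz[of z] d(1) by simp
        have "(?g has_field_derivative deriv ?g z) (at z)"
          by (simp add: F_def iterate_has_field_derivative[OF hol])
        from DERIV_inverse_fun[OF this z] show ?thesis
          by (intro DERIV_imp_deriv) (simp add: power2_eq_square field_simps)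
      qed
      ultimately have le: "cmod (deriv ?g z) / (cmod (?g z))\<^sup>2 \<le> 1 / d"
        by (simp add: norm_divide norm_power)
      have "0 < cmod (?g z)" using nz[of z] d(1) by simp
      then have "spherical_deriv ?g z \<le> cmod (deriv ?g z) / (cmod (?g z))\<^sup>2"
        unfolding spherical_deriv_def by (intro divide_left_mono) (auto simp: add_pos_nonneg)
      then show ?case using le by linarith
    qed
    then show ?thesis by blast
  qed
  then obtain B where B: "\<forall>\<^sub>F i in sequentially. spherical_deriv ((F \<circ> r) i) z \<le> B" by blast
  have "\<forall>\<^sub>F i in sequentially. B \<le> real i"
    using filterlim_real_sequentially by (simp add: filterlim_at_top)
  with B have "\<forall>\<^sub>F i::nat in sequentially. False"
    by eventually_elim (use large in \<open>meson not_le order_trans\<close>)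
  then show False by simp
qed

lemma eventually_power_less:
  fixes A B c :: real
  assumes "c > 0" "1 \<le> B" "B < A"
  obtains n1 where "\<And>n. n \<ge> n1 \<Longrightarrow> B ^ n < c * A ^ n"
proof -
  have AB: "1 < A / B" using assms by simp
  obtain n1 where n1: "1 / c < (A / B) ^ n1" using real_arch_pow[OF AB] by blast
  show ?thesis
  proof
    fix n assume "n \<ge> n1"
    then have "(A / B) ^ n1 \<le> (A / B) ^ n" using AB by (intro power_increasing) auto
    with n1 have "1 / c < (A / B) ^ n" by linarith
    then show "B ^ n < c * A ^ n" using assms by (simp add: power_divide field_simps)
  qed
qed

lemma deriv_iterate_nonzero_before:
  assumes "f holomorphic_on UNIV" "deriv (f ^^ N) x \<noteq> 0" "j \<le> N"
  shows "deriv (f ^^ j) x \<noteq> 0"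
  using deriv_iterate_add[OF assms(1), of "N - j" j x] assms(2,3) by auto

lemma spherical_deriv_growth_at_periodic_point:
  assumes hol: "f holomorphic_on UNIV" and A: "A \<ge> 1"
    and per: "(f ^^ N) x = x" and mult: "A ^ N < cmod (deriv (f ^^ N) x)"
  obtains c where "c > 0" "\<And>n. c * A ^ n \<le> spherical_deriv (f ^^ n) x"
proof -
  have N: "N > 0" using mult by (cases N) (auto simp: id_def)
  have nz: "deriv (f ^^ N) x \<noteq> 0" using mult A by (auto simp: not_less)
  define b where "b = Min ((\<lambda>j. spherical_deriv (f ^^ j) x) ` {..<N})"
  have "0 < spherical_deriv (f ^^ j) x" if "j < N" for j
    using deriv_iterate_nonzero_before[OF hol nz, of j] that by (simp add: spherical_deriv_pos_iff)
  then have b: "b > 0" unfolding b_def using N by (subst Min_gr_iff) auto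
  define c where "c = b / A ^ N"
  have AN: "A ^ N > 0" using A by simp
  have c: "c > 0" using b AN by (simp add: c_def)
  have "c * A ^ n \<le> spherical_deriv (f ^^ n) x" for n
  proof (induction n rule: less_induct)
    case (less n)
    show ?case
    proof (cases "n < N")
      case True
      have "c * A ^ n \<le> c * A ^ N" using c A True by (intro mult_left_mono power_increasing) auto
      also have "\<dots> = b" using A by (simp add: c_def)
      also have "\<dots> \<le> spherical_deriv (f ^^ n) x" unfolding b_def using True by (intro Min_le) auto
      finally show ?thesis .
    next
      case False
      then have n: "n = (n - N) + N" by simp
      have "c * A ^ n = (c * A ^ (n - N)) * A ^ N" by (subst n) (simp add: power_add)
      also have "\<dots> \<le> spherical_deriv (f ^^ (n - N)) x * cmod (deriv (f ^^ N) x)"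
        using less[of "n - N"] False N mult c A by (intro mult_mono) (auto simp: spherical_deriv_def)
      also have "\<dots> = spherical_deriv (f ^^ n) x"
        using spherical_deriv_iterate_add[OF hol, of "n - N" N x] per n by simp
      finally show ?thesis .
    qed
  qed
  then show ?thesis using that c by blast
qed

section \<open>Passing from one cycle to a more repelling one\<close>

text \<open>
  Near a repelling periodic point the return map $f^N$ expands distances from $x$, so it has a right inverse
  that contracts a small disc towards $x$.  Iterating this inverse from any point $y$ of the disc
  gives the backward orbit.
\<close>

lemma backward_orbits_to_repelling_periodic_point:
  assumes hol: "f holomorphic_on UNIV" and L: "\<Lambda> \<ge> 1"
    and per: "(f ^^ N) x = x" and mult: "\<Lambda> < cmod (deriv (f ^^ N) x)"
  obtains \<rho> b where "\<rho> > 0" "b > 0"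
    "\<And>y. y \<in> ball x \<rho> \<Longrightarrow> \<exists>Y. Y 0 = y \<and> Y \<longlonglongrightarrow> x \<and>
       (\<forall>q. (f ^^ N) (Y (Suc q)) = Y q \<and> \<Lambda> \<le> cmod (deriv (f ^^ N) (Y (Suc q))) \<and>
            (\<forall>j<N. b \<le> spherical_deriv (f ^^ j) (Y (Suc q))))"
proof -
  let ?g = "f ^^ N"
  have holg: "?g holomorphic_on UNIV" by (rule holomorphic_on_compow[OF hol])
  have nz: "deriv ?g x \<noteq> 0" using mult L by auto
  have pos: "0 < spherical_deriv (f ^^ j) x" if "j < N" for j
    using deriv_iterate_nonzero_before[OF hol nz, of j] that by (simp add: spherical_deriv_pos_iff)
  define b where "b = Min (insert 1 ((\<lambda>j. spherical_deriv (f ^^ j) x / 2) ` {..<N}))"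
  have b: "b > 0" unfolding b_def using pos by (subst Min_gr_iff) auto
  have bj: "b < spherical_deriv (f ^^ j) x" if "j < N" for j
  proof -
    have "b \<le> spherical_deriv (f ^^ j) x / 2" unfolding b_def using that by (intro Min_le) auto
    then show ?thesis using pos[OF that] by linarith
  qed
  obtain \<mu> where \<mu>: "\<Lambda> < \<mu>" "\<mu> < cmod (deriv ?g x)" using dense[OF mult] by blast
  have \<mu>1: "\<mu> > 1" using \<mu> L by linarith
  have "continuous_on UNIV (deriv ?g)"
    using holg by (intro holomorphic_on_imp_continuous_on holomorphic_deriv) auto
  then have "isCont (\<lambda>v. cmod (deriv ?g v)) x"
    by (intro continuous_intros) (simp add: continuous_on_eq_continuous_at)
  then have 1: "\<forall>\<^sub>F v in at x. \<Lambda> < cmod (deriv ?g v)"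
    using mult by (intro order_tendstoD(1)) (auto simp: isCont_def)
  have 2: "\<forall>\<^sub>F v in at x. \<forall>j\<in>{..<N}. b < spherical_deriv (f ^^ j) v"
  proof (rule eventually_ball_finite)
    show "\<forall>j\<in>{..<N}. \<forall>\<^sub>F v in at x. b < spherical_deriv (f ^^ j) v"
      using isCont_spherical_deriv[OF holomorphic_on_compow[OF hol]] bj
      by (auto intro!: order_tendstoD(1) simp: isCont_def)
  qed simp
  have "((\<lambda>v. (?g v - ?g x) / (v - x)) \<longlongrightarrow> deriv ?g x) (at x)"
    using iterate_has_field_derivative[OF hol, of N x] by (simp add: has_field_derivative_iff)
  then have "((\<lambda>v. cmod ((?g v - ?g x) / (v - x))) \<longlongrightarrow> cmod (deriv ?g x)) (at x)"
    by (rule tendsto_norm)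
  then have 3: "\<forall>\<^sub>F v in at x. \<mu> < cmod ((?g v - ?g x) / (v - x))"
    using \<mu>(2) by (rule order_tendstoD(1))
  have "\<forall>\<^sub>F v in at x. \<Lambda> < cmod (deriv ?g v) \<and> (\<forall>j\<in>{..<N}. b < spherical_deriv (f ^^ j) v) \<and>
      \<mu> < cmod ((?g v - ?g x) / (v - x))"
    using 1 2 3 by eventually_elim blast
  then obtain \<rho>1 where \<rho>1: "\<rho>1 > 0" "\<And>v. v \<noteq> x \<Longrightarrow> dist v x < \<rho>1 \<Longrightarrow>
      \<Lambda> < cmod (deriv ?g v) \<and> (\<forall>j\<in>{..<N}. b < spherical_deriv (f ^^ j) v) \<and>
      \<mu> < cmod ((?g v - ?g x) / (v - x))"
    unfolding eventually_at by blast
  have good: "\<Lambda> \<le> cmod (deriv ?g v) \<and> (\<forall>j<N. b \<le> spherical_deriv (f ^^ j) v)"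
    if "v \<in> ball x \<rho>1" for v
  proof (cases "v = x")
    case True
    then show ?thesis using mult bj less_imp_le by blast
  next
    case False
    then show ?thesis using \<rho>1(2)[OF False] that by (auto simp: dist_commute less_imp_le)
  qed
  have expand: "\<mu> * dist v x \<le> dist (?g v) x" if "v \<in> ball x \<rho>1" for v
  proof (cases "v = x")
    case False
    then have "\<mu> < cmod ((?g v - ?g x) / (v - x))" using \<rho>1(2)[OF False] that by (simp add: dist_commute)
    then show ?thesis using False per by (simp add: norm_divide dist_norm field_simps)
  qed simp
  have "\<not> ?g constant_on UNIV"
  proof
    assume "?g constant_on UNIV"
    then obtain d where "?g = (\<lambda>_. d)" by (auto simp: constant_on_def)
    then show False using nz by simp
  qed
  then have "open (?g ` ball x \<rho>1)"
    using open_mapping_thm[OF holg open_UNIV connected_UNIV open_ball] by auto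
  moreover have "x \<in> ?g ` ball x \<rho>1" using per \<rho>1(1) by (intro image_eqI[of _ _ x]) auto
  ultimately obtain \<rho>2 where \<rho>2: "\<rho>2 > 0" "ball x \<rho>2 \<subseteq> ?g ` ball x \<rho>1" using open_contains_ball by blast
  have "\<exists>v. v \<in> ball x \<rho>1 \<and> ?g v = y" if "y \<in> ball x \<rho>2" for y using \<rho>2(2) that by blast
  then obtain \<psi> where \<psi>: "\<And>y. y \<in> ball x \<rho>2 \<Longrightarrow> \<psi> y \<in> ball x \<rho>1 \<and> ?g (\<psi> y) = y" by metis
  have contract: "dist (\<psi> y) x \<le> dist y x / \<mu>" if y: "y \<in> ball x \<rho>2" for y
  proof -
    have "\<mu> * dist (\<psi> y) x \<le> dist y x" using expand[of "\<psi> y"] \<psi>[OF y] by simp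
    then show ?thesis using \<mu>1 by (simp add: field_simps)
  qed
  show ?thesis
  proof
    show "\<rho>2 > 0" "b > 0" by fact+
    fix y assume y: "y \<in> ball x \<rho>2"
    define Y where "Y = (\<lambda>q. (\<psi> ^^ q) y)"
    have Y: "Y q \<in> ball x \<rho>2 \<and> dist (Y q) x \<le> dist y x / \<mu> ^ q" for q
    proof (induction q)
      case 0
      then show ?case using y by (simp add: Y_def)
    next
      case (Suc q)
      have "dist (Y (Suc q)) x \<le> dist (Y q) x / \<mu>" using contract Suc by (simp add: Y_def)
      moreover have "dist (Y q) x / \<mu> \<le> dist y x / \<mu> ^ q / \<mu>"
        using Suc \<mu>1 by (intro divide_right_mono) auto
      moreover have "dist (Y q) x / \<mu> \<le> dist (Y q) x / 1" using \<mu>1 by (intro divide_left_mono) auto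
      ultimately show ?case using Suc by (auto simp: dist_commute field_simps)
    qed
    have "(\<lambda>q. dist y x * (1 / \<mu>) ^ q) \<longlonglongrightarrow> dist y x * 0"
      using \<mu>1 by (intro tendsto_mult tendsto_const LIMSEQ_power_zero) auto
    then have lim0: "(\<lambda>q. dist y x * (1 / \<mu>) ^ q) \<longlonglongrightarrow> 0" by simp
    have "(\<lambda>q. dist (Y q) x) \<longlonglongrightarrow> 0"
    proof (rule Lim_null_comparison[OF _ lim0])
      show "\<forall>\<^sub>F q in sequentially. norm (dist (Y q) x) \<le> dist y x * (1 / \<mu>) ^ q"
        using Y by (simp add: power_divide)
    qed
    then have "Y \<longlonglongrightarrow> x" by (subst tendsto_dist_iff)
    moreover have "?g (Y (Suc q)) = Y q \<and> \<Lambda> \<le> cmod (deriv ?g (Y (Suc q))) \<and>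
            (\<forall>j<N. b \<le> spherical_deriv (f ^^ j) (Y (Suc q)))" for q
      using \<psi>[of "Y q"] good[of "Y (Suc q)"] Y[of q] by (simp add: Y_def)
    ultimately show "\<exists>Y. Y 0 = y \<and> Y \<longlonglongrightarrow> x \<and>
       (\<forall>q. ?g (Y (Suc q)) = Y q \<and> \<Lambda> \<le> cmod (deriv ?g (Y (Suc q))) \<and>
            (\<forall>j<N. b \<le> spherical_deriv (f ^^ j) (Y (Suc q))))"
      by (intro exI[of _ Y]) (simp add: Y_def)
  qed
qed

text \<open>
  The orbit of $z$ ends, without passing through a critical point, in a cycle whose Lyapunov
  exponent is above $\log A$.  The case $N = 0$ is excluded by the strict inequality, since the
  identity has derivative $1 = A^0$.
\<close>

definition preperiodic_exponent_above :: "(complex \<Rightarrow> complex) \<Rightarrow> real \<Rightarrow> complex \<Rightarrow> bool" where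
  "preperiodic_exponent_above f A z \<longleftrightarrow>
     (\<exists>m N x. (f ^^ m) z = x \<and> deriv (f ^^ m) z \<noteq> 0 \<and> (f ^^ N) x = x \<and>
        A ^ N < cmod (deriv (f ^^ N) x))"

lemma periodic_exponent_above:
  assumes "(f ^^ N) x = x" "A ^ N < cmod (deriv (f ^^ N) x)"
  shows "preperiodic_exponent_above f A x"
proof -
  have "deriv (f ^^ 0) x \<noteq> 0" by (simp add: id_def)
  then show ?thesis
    unfolding preperiodic_exponent_above_def using assms
    by - (rule exI[of _ 0], rule exI[of _ N], rule exI[of _ x], simp)
qed

lemma preperiodic_spherical_deriv_eventually:
  assumes hol: "f holomorphic_on UNIV" and z: "preperiodic_exponent_above f A z" and B: "1 \<le> B" "B < A"
  obtains n0 where "\<And>n. n \<ge> n0 \<Longrightarrow> B ^ n < spherical_deriv (f ^^ n) z"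
proof -
  obtain m N x where x: "(f ^^ m) z = x" "deriv (f ^^ m) z \<noteq> 0" "(f ^^ N) x = x"
    "A ^ N < cmod (deriv (f ^^ N) x)"
    using z unfolding preperiodic_exponent_above_def by blast
  have A: "A \<ge> 1" using B by simp
  obtain c where c: "c > 0" "\<And>n. c * A ^ n \<le> spherical_deriv (f ^^ n) x"
    using spherical_deriv_growth_at_periodic_point[OF hol A x(3,4)] by blast
  define d where "d = c / A ^ m * cmod (deriv (f ^^ m) z)"
  have d: "d > 0" using c(1) A x(2) by (simp add: d_def)
  obtain n1 where n1: "\<And>n. n \<ge> n1 \<Longrightarrow> B ^ n < d * A ^ n" using eventually_power_less[OF d B] by blast
  show ?thesis
  proof
    fix n assume n: "n \<ge> max n1 m"
    then have nm: "n = (n - m) + m" by simp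
    have "d * A ^ n = c * A ^ (n - m) * cmod (deriv (f ^^ m) z)"
      using A by (subst nm) (simp add: d_def power_add)
    also have "\<dots> \<le> spherical_deriv (f ^^ (n - m)) x * cmod (deriv (f ^^ m) z)"
      by (intro mult_right_mono c(2)) auto
    also have "\<dots> = spherical_deriv (f ^^ n) z"
      using spherical_deriv_iterate_add[OF hol, of "n - m" m z] x(1) nm by simp
    finally show "B ^ n < spherical_deriv (f ^^ n) z" using n1[of n] n by simp
  qed
qed

lemma Julia_set_if_spherical_deriv_growth:
  assumes hol: "f holomorphic_on UNIV" and B: "B > 1"
    and grow: "\<And>n. n \<ge> n0 \<Longrightarrow> B ^ n < spherical_deriv (f ^^ n) z"
  shows "z \<in> Julia_set f"
proof (rule ccontr)
  assume "z \<notin> Julia_set f"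
  then obtain C where C: "\<And>n. spherical_deriv (f ^^ n) z \<le> C"
    using spherical_deriv_iterates_bounded_on_Fatou[OF hol] by blast
  obtain n where "C < B ^ n" using real_arch_pow[OF B] by blast
  also have "B ^ n \<le> B ^ (n + n0)" using B by (intro power_increasing) auto
  also have "\<dots> < spherical_deriv (f ^^ (n + n0)) z" by (intro grow) auto
  finally show False using C[of "n + n0"] by simp
qed

text \<open>
  The orbit of $z$ ends in the cycle of a point $x$.  Arbitrarily close to $x$ there is a more
  repelling periodic point $y$.  Backward orbits $Y_q$ of $y$ converge to $x$, and $z'$ is chosen near
  $z$ with $f^m(z') = Y_q$ for a large $q$: its orbit follows that of $z$, stays near the cycle of $x$ for
  about $qN$ steps and then settles in the cycle of $y$.  The growth estimate has a constant that does not
  depend on $q$; it is enough from some time $n_1$ on that does not depend on $q$ either, and at the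
  finitely many times before $n_1$ continuity suffices.
\<close>

lemma perturb_to_larger_exponent:
  assumes f: "transcendental_entire f" and z: "preperiodic_exponent_above f A z"
    and B: "1 \<le> B" "B < A" "A \<le> A'" and e: "e > 0"
    and grow: "\<And>n. n \<ge> n0 \<Longrightarrow> B ^ n < spherical_deriv (f ^^ n) z"
  obtains z' where "dist z z' < e" "preperiodic_exponent_above f A' z'"
    "\<And>n. n \<ge> n0 \<Longrightarrow> B ^ n < spherical_deriv (f ^^ n) z'"
proof -
  have hol: "f holomorphic_on UNIV" using f by (simp add: transcendental_entire_def)
  obtain m N x where x: "(f ^^ m) z = x" "deriv (f ^^ m) z \<noteq> 0" "(f ^^ N) x = x"
    "A ^ N < cmod (deriv (f ^^ N) x)"
    using z unfolding preperiodic_exponent_above_def by blast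
  have A: "A > 1" using B by simp
  have AN: "A ^ N \<ge> 1" using A by (intro one_le_power) auto
  obtain \<rho> b where \<rho>: "\<rho> > 0" "b > 0"
    "\<And>y. y \<in> ball x \<rho> \<Longrightarrow> \<exists>Y. Y 0 = y \<and> Y \<longlonglongrightarrow> x \<and>
       (\<forall>q. (f ^^ N) (Y (Suc q)) = Y q \<and> A ^ N \<le> cmod (deriv (f ^^ N) (Y (Suc q))) \<and>
            (\<forall>j<N. b \<le> spherical_deriv (f ^^ j) (Y (Suc q))))"
    using backward_orbits_to_repelling_periodic_point[OF hol AN x(3,4)] by blast
  have "x \<in> Julia_set f"
  proof -
    define B' where "B' = (1 + A) / 2"
    have B': "1 < B'" "B' < A" using A by (auto simp: B'_def)
    have "preperiodic_exponent_above f A x"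
      using x(3,4) by (rule periodic_exponent_above)
    then obtain k0 where "\<And>n. n \<ge> k0 \<Longrightarrow> B' ^ n < spherical_deriv (f ^^ n) x"
      using preperiodic_spherical_deriv_eventually[OF hol] B' less_imp_le by metis
    then show ?thesis by (rule Julia_set_if_spherical_deriv_growth[OF hol B'(1)])
  qed
  moreover have A'1: "A' \<ge> 1" using A B by simp
  ultimately obtain y N' where y: "dist x y < \<rho>" "(f ^^ N') y = y" "A' ^ N' < cmod (deriv (f ^^ N') y)"
    using periodic_points_of_large_multiplier_dense[OF f _ \<rho>(1)] by metis
  have "A ^ N' \<le> A' ^ N'" using A B by (intro power_mono) auto
  then have "A ^ N' < cmod (deriv (f ^^ N') y)" using y(3) by linarith
  then obtain cy where cy: "cy > 0" "\<And>n. cy * A ^ n \<le> spherical_deriv (f ^^ n) y"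
    using spherical_deriv_growth_at_periodic_point[OF hol less_imp_le[OF A] y(2)] by blast
  obtain Y where Y: "Y 0 = y" "Y \<longlonglongrightarrow> x" "\<And>q. (f ^^ N) (Y (Suc q)) = Y q"
    "\<And>q. A ^ N \<le> cmod (deriv (f ^^ N) (Y (Suc q)))"
    "\<And>q j. j < N \<Longrightarrow> b \<le> spherical_deriv (f ^^ j) (Y (Suc q))"
    using \<rho>(3)[of y] y(1) by auto
  define c where "c = min cy (b / A ^ N)"
  have c: "c > 0" using cy(1) \<rho>(2) A by (simp add: c_def)
  \<comment> \<open>The constant does not depend on \<open>q\<close>: each turn around the cycle multiplies the derivative by at least \<open>A ^ N\<close>.\<close>
  have growY: "c * A ^ n \<le> spherical_deriv (f ^^ n) (Y q)" for n q
  proof (induction q arbitrary: n)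
    case 0
    have "c * A ^ n \<le> cy * A ^ n" using A by (intro mult_right_mono) (auto simp: c_def)
    then show ?case using cy(2)[of n] Y(1) by simp
  next
    case (Suc q)
    show ?case
    proof (cases "n < N")
      case True
      have "c * A ^ n \<le> b / A ^ N * A ^ N"
        using A True \<rho>(2) by (intro mult_mono power_increasing) (auto simp: c_def)
      also have "\<dots> = b" using A by simp
      also have "\<dots> \<le> spherical_deriv (f ^^ n) (Y (Suc q))" using Y(5) True by blast
      finally show ?thesis .
    next
      case False
      then have n: "n = (n - N) + N" by simp
      have "c * A ^ n = (c * A ^ (n - N)) * A ^ N" by (subst n) (simp add: power_add)
      also have "\<dots> \<le> spherical_deriv (f ^^ (n - N)) (Y q) * cmod (deriv (f ^^ N) (Y (Suc q)))"
      proof (rule mult_mono)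
        show "0 \<le> spherical_deriv (f ^^ (n - N)) (Y q)" by (simp add: spherical_deriv_def)
      qed (use Suc Y(4) A in auto)
      also have "\<dots> = spherical_deriv (f ^^ n) (Y (Suc q))"
        using spherical_deriv_iterate_add[OF hol, of "n - N" N "Y (Suc q)"] Y(3)[of q] n by simp
      finally show ?thesis .
    qed
  qed
  have orbY: "(f ^^ (q * N)) (Y q) = y \<and> deriv (f ^^ (q * N)) (Y q) \<noteq> 0" for q
  proof (induction q)
    case 0
    then show ?case by (simp add: Y(1) id_def)
  next
    case (Suc q)
    have "deriv (f ^^ N) (Y (Suc q)) \<noteq> 0" using Y(4)[of q] AN by auto
    then have "deriv (f ^^ (q * N + N)) (Y (Suc q)) \<noteq> 0"
      unfolding deriv_iterate_add[OF hol] Y(3) using Suc by simp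
    moreover have "(f ^^ (q * N + N)) (Y (Suc q)) = y"
      unfolding funpow_add comp_apply Y(3) using Suc by blast
    ultimately show ?case by (metis add.commute mult_Suc)
  qed
  define \<delta> where "\<delta> = cmod (deriv (f ^^ m) z) / 2"
  have \<delta>: "\<delta> > 0" using x(2) by (simp add: \<delta>_def)
  have d: "c / A ^ m * \<delta> > 0" using c \<delta> A by simp
  obtain n1 where n1: "\<And>n. n \<ge> n1 \<Longrightarrow> B ^ n < c / A ^ m * \<delta> * A ^ n"
    using eventually_power_less[OF d B(1,2)] by blast
  \<comment> \<open>On \<open>W\<close> the finitely many times before \<open>max n1 m\<close> are settled by continuity.\<close>
  define W where "W = {v. \<delta> < cmod (deriv (f ^^ m) v)} \<inter> ball z e \<inter>
      (\<Inter>n\<in>{n0..<max n1 m}. {v. B ^ n < spherical_deriv (f ^^ n) v})"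
  have "open W"
  proof -
    have "continuous_on UNIV (\<lambda>v. cmod (deriv (f ^^ m) v))"
      by (intro continuous_intros holomorphic_on_imp_continuous_on holomorphic_deriv holomorphic_on_compow hol) auto
    then have "open {v. \<delta> < cmod (deriv (f ^^ m) v)}" by (intro open_Collect_less) auto
    moreover have "open {v. B ^ n < spherical_deriv (f ^^ n) v}" for n
    proof -
      have "continuous_on UNIV (spherical_deriv (f ^^ n))"
        using isCont_spherical_deriv[OF holomorphic_on_compow[OF hol]]
        by (simp add: continuous_on_eq_continuous_at)
      then show ?thesis by (intro open_Collect_less) auto
    qed
    ultimately show ?thesis unfolding W_def by (intro open_Int open_INT) auto
  qed
  moreover have "\<not> f ^^ m constant_on UNIV" by (rule iterate_nonconstant[OF f])
  ultimately have "open ((f ^^ m) ` W)"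
    using open_mapping_thm[OF holomorphic_on_compow[OF hol] open_UNIV connected_UNIV] by auto
  moreover have "z \<in> W" using grow e \<delta> by (auto simp: W_def \<delta>_def)
  then have "x \<in> (f ^^ m) ` W" using x(1) by blast
  ultimately have "\<forall>\<^sub>F q in sequentially. Y q \<in> (f ^^ m) ` W" using Y(2) by (rule topological_tendstoD[rotated])
  then obtain q where "Y q \<in> (f ^^ m) ` W" by (meson eventually_happens sequentially_bot)
  then obtain z' where z': "z' \<in> W" "(f ^^ m) z' = Y q" by auto
  show ?thesis
  proof
    show "dist z z' < e" using z'(1) by (simp add: W_def)
    have "deriv (f ^^ m) z' \<noteq> 0" using z'(1) \<delta> by (auto simp: W_def)
    then have "deriv (f ^^ (q * N + m)) z' \<noteq> 0"
      unfolding deriv_iterate_add[OF hol] z'(2) using orbY[of q] by simp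
    moreover have "(f ^^ (q * N + m)) z' = y"
      unfolding funpow_add comp_apply z'(2) using orbY[of q] by blast
    ultimately show "preperiodic_exponent_above f A' z'"
      unfolding preperiodic_exponent_above_def using y by blast
    fix n assume n: "n \<ge> n0"
    show "B ^ n < spherical_deriv (f ^^ n) z'"
    proof (cases "n < max n1 m")
      case True
      then show ?thesis using z'(1) n by (auto simp: W_def)
    next
      case False
      then have nm: "n = (n - m) + m" "n \<ge> n1" by auto
      have "B ^ n < c / A ^ m * \<delta> * A ^ n" using n1 nm by blast
      also have "\<dots> = c * A ^ (n - m) * \<delta>"
        using A by (subst nm) (simp add: power_add)
      also have "\<dots> \<le> spherical_deriv (f ^^ (n - m)) (Y q) * cmod (deriv (f ^^ m) z')"
        using growY z'(1) \<delta> by (intro mult_mono) (auto simp: W_def spherical_deriv_def)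
      also have "\<dots> = spherical_deriv (f ^^ n) z'"
        using spherical_deriv_iterate_add[OF hol, of "n - m" m z'] z'(2) nm by simp
      finally show ?thesis .
    qed
  qed
qed

section \<open>Points of infinite Lyapunov exponent\<close>

lemma has_Lyapunov_exponent_infinity:
  assumes grow: "\<And>k. \<forall>\<^sub>F n in sequentially. real (Suc k) ^ n < spherical_deriv (f ^^ n) z"
  shows "has_Lyapunov_exponent f z \<infinity>"
  unfolding has_Lyapunov_exponent_def tendsto_PInfty
proof
  fix r :: real
  obtain k where k: "exp r < real k" using reals_Archimedean2 by blast
  have "\<forall>\<^sub>F n in sequentially. n \<ge> (1::nat)" by (rule eventually_ge_at_top)
  with grow[of k]
  show "\<forall>\<^sub>F n in sequentially. ereal r < ereal (1 / real n) * log_ereal (spherical_deriv (f ^^ n) z)"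
  proof eventually_elim
    case (elim n)
    let ?s = "spherical_deriv (f ^^ n) z"
    have pos: "0 < real (Suc k) ^ n" by simp
    then have s: "0 < ?s" using elim by linarith
    have "ln (exp r) < ln (real (Suc k))"
      using k by (subst ln_less_cancel_iff) auto
    then have "r < ln (real (Suc k))" by simp
    then have "real n * r < real n * ln (real (Suc k))" using elim(2) by simp
    also have "\<dots> = ln (real (Suc k) ^ n)" by (simp add: ln_realpow)
    also have "\<dots> < ln ?s" using elim(1) pos s by (subst ln_less_cancel_iff) auto
    finally have "r < 1 / real n * ln ?s" using elim(2) by (simp add: field_simps)
    then show ?case using s by (simp add: log_ereal_def)
  qed
qed

text \<open>
  Starting from a periodic point near $p$, the exponents are raised one after the other by smaller and
  smaller perturbations.  In stage $k$ the spherical derivatives exceed $(k+1)^n$ for all large $n$,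
  and a new stage begins after a finite time only, so the closed discs can be chosen to preserve the
  estimates achieved up to that time.  The common point of the discs inherits all of them.
\<close>

theorem theorem1p4:
  fixes f :: "complex \<Rightarrow> complex"
  assumes "transcendental_entire f"
  shows "Julia_set f \<subseteq> closure (Julia_set f \<inter> {z. has_Lyapunov_exponent f z \<infinity>})"
proof
  fix p assume p: "p \<in> Julia_set f"
  have hol: "f holomorphic_on UNIV" using assms by (simp add: transcendental_entire_def)
  show "p \<in> closure (Julia_set f \<inter> {z. has_Lyapunov_exponent f z \<infinity>})"
    unfolding closure_approachable
  proof (intro allI impI)
    fix \<epsilon> :: real assume \<epsilon>: "\<epsilon> > 0"
    \<comment> \<open>State of stage \<open>k\<close>: a point, the radius of a disc around it, and the time from which its growth estimate holds.\<close>
    define P where "P = (\<lambda>k (z, e :: real, n0 :: nat). preperiodic_exponent_above f (real k + 2) z \<and> 0 < e \<and>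
      (\<forall>n\<ge>n0. (real k + 1) ^ n < spherical_deriv (f ^^ n) z))"
    define Q where "Q = (\<lambda>k (z, e :: real, n0 :: nat) (z', e', n0'). cball z' e' \<subseteq> cball z e \<and> n0 < n0' \<and>
      (\<forall>n. n0 \<le> n \<and> n < n0' \<longrightarrow> (\<forall>v\<in>cball z' e'. (real k + 1) ^ n < spherical_deriv (f ^^ n) v)))"
    obtain x N where x: "dist p x < \<epsilon> / 2" "(f ^^ N) x = x" "2 ^ N < cmod (deriv (f ^^ N) x)"
      by (rule periodic_points_of_large_multiplier_dense[OF assms p, of "\<epsilon> / 2" 2]) (use \<epsilon> in auto)
    have x2: "preperiodic_exponent_above f 2 x"
      using x(2,3) by (rule periodic_exponent_above)
    obtain n00 where "\<And>n. n \<ge> n00 \<Longrightarrow> 1 ^ n < spherical_deriv (f ^^ n) x"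
      by (rule preperiodic_spherical_deriv_eventually[OF hol x2, of 1]) auto
    then have start: "P 0 (x, \<epsilon> / 2, n00)" using x2 \<epsilon> by (simp add: P_def)
    have step: "\<exists>s'. P (Suc k) s' \<and> Q k s s'" if "P k s" for k s
    proof -
      obtain z e n0 where s: "s = (z, e, n0)" by (cases s) auto
      have z: "preperiodic_exponent_above f (real k + 2) z" "0 < e"
        "\<And>n. n \<ge> n0 \<Longrightarrow> (real k + 1) ^ n < spherical_deriv (f ^^ n) z"
        using that by (auto simp: P_def s)
      obtain z' where z': "dist z z' < e" "preperiodic_exponent_above f (real k + 3) z'"
        "\<And>n. n \<ge> n0 \<Longrightarrow> (real k + 1) ^ n < spherical_deriv (f ^^ n) z'"
        using perturb_to_larger_exponent[OF assms z(1), of "real k + 1" "real k + 3" e n0] z by auto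
      obtain n1 where n1: "\<And>n. n \<ge> n1 \<Longrightarrow> (real k + 2) ^ n < spherical_deriv (f ^^ n) z'"
        by (rule preperiodic_spherical_deriv_eventually[OF hol z'(2), of "real k + 2"]) auto
      define n0' where "n0' = max n1 (Suc n0)"
      define W where "W = ball z e \<inter> (\<Inter>n\<in>{n0..<n0'}. {v. (real k + 1) ^ n < spherical_deriv (f ^^ n) v})"
      have "open {v. (real k + 1) ^ n < spherical_deriv (f ^^ n) v}" for n
      proof -
        have "continuous_on UNIV (spherical_deriv (f ^^ n))"
          using isCont_spherical_deriv[OF holomorphic_on_compow[OF hol]]
          by (simp add: continuous_on_eq_continuous_at)
        then show ?thesis by (intro open_Collect_less) auto
      qed
      then have "open W" unfolding W_def by (intro open_Int open_INT) auto
      moreover have "z' \<in> W" using z'(1,3) by (auto simp: W_def)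
      ultimately obtain e' where e': "e' > 0" "cball z' e' \<subseteq> W" using open_contains_cball by blast
      have "P (Suc k) (z', e', n0')"
        using z'(2) e'(1) n1 by (simp add: P_def n0'_def add.commute add.left_commute)
      moreover have "Q k s (z', e', n0')"
        using e'(2) unfolding Q_def s W_def by (auto simp: n0'_def subset_iff less_imp_le)
      ultimately show ?thesis by blast
    qed
    obtain S where S: "\<And>k. P k (S k)" "\<And>k. Q k (S k) (S (Suc k))" "S 0 = (x, \<epsilon> / 2, n00)"
    proof -
      have "\<exists>S. \<forall>k. (P k (S k) \<and> (k = 0 \<longrightarrow> S k = (x, \<epsilon> / 2, n00))) \<and> Q k (S k) (S (Suc k))"
        by (rule dependent_nat_choice) (use start step in auto)
      then show ?thesis using that by blast
    qed
    define C where "C = (\<lambda>k. cball (fst (S k)) (fst (snd (S k))))"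
    define n where "n = (\<lambda>k. snd (snd (S k)))"
    have P': "0 < fst (snd (S k))" for k using S(1)[of k] by (auto simp: P_def split: prod.splits)
    have C: "C (Suc k) \<subseteq> C k" and n: "n k < n (Suc k)"
      and big: "\<And>i v. \<lbrakk>n k \<le> i; i < n (Suc k); v \<in> C (Suc k)\<rbrakk> \<Longrightarrow> (real k + 1) ^ i < spherical_deriv (f ^^ i) v" for k
      using S(2)[of k] by (auto simp: Q_def C_def n_def split: prod.splits)
    have "\<Inter>(range C) \<noteq> {}"
    proof (rule compact_nest)
      show "compact (C k)" "C k \<noteq> {}" for k using P'[of k] by (auto simp: C_def)
      show "C k \<subseteq> C l" if "l \<le> k" for l k using C lift_Suc_antimono_le that by blast
    qed
    then obtain w where w: "\<And>k. w \<in> C k" by blast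
    have nmono: "strict_mono n" using n by (simp add: strict_mono_Suc_iff)
    have above: "(real k + 1) ^ i < spherical_deriv (f ^^ i) w" if i: "n k \<le> i" for k i
    proof -
      define l where "l = (GREATEST l. n l \<le> i)"
      have bound: "\<forall>l. n l \<le> i \<longrightarrow> l \<le> i" using seq_suble[OF nmono] order_trans by blast
      have l1: "n l \<le> i" unfolding l_def by (rule GreatestI_nat[of _ k]) (use i bound in auto)
      have kl: "k \<le> l" unfolding l_def by (rule Greatest_le_nat[of _ k]) (use i bound in auto)
      have "\<not> n (Suc l) \<le> i"
      proof
        assume "n (Suc l) \<le> i"
        then have "Suc l \<le> (GREATEST l. n l \<le> i)"
          by (rule Greatest_le_nat) (rule bound[rule_format])
        then show False by (simp only: l_def[symmetric] not_less_eq_eq order_refl)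
      qed
      then have "(real l + 1) ^ i < spherical_deriv (f ^^ i) w" using big[OF l1 _ w] by simp
      moreover have "(real k + 1) ^ i \<le> (real l + 1) ^ i" using kl by (intro power_mono) auto
      ultimately show ?thesis by linarith
    qed
    have "w \<in> Julia_set f"
      by (rule Julia_set_if_spherical_deriv_growth[OF hol _ above[of 1]]) auto
    moreover have "has_Lyapunov_exponent f w \<infinity>"
    proof (rule has_Lyapunov_exponent_infinity)
      show "\<forall>\<^sub>F i in sequentially. real (Suc k) ^ i < spherical_deriv (f ^^ i) w" for k
        using above[of k] unfolding eventually_sequentially by (metis Suc_eq_plus1 of_nat_Suc add.commute)
    qed
    moreover have "dist w p < \<epsilon>"
      using w[of 0] x(1) dist_triangle[of w p x] by (simp add: C_def S(3) dist_commute)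
    ultimately show "\<exists>y\<in>Julia_set f \<inter> {z. has_Lyapunov_exponent f z \<infinity>}. dist y p < \<epsilon>" by blast
  qed
qed

end
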